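(* For every fixed $\omega\in\Omega_0^*\cap\Omega_1^*$ and all real numbers $M,a,b$ with $M>0$ and $1/\alpha<a<b<1$, one has (with the convention $0/0=0$) $$\sup_{(u_1,u_2,v_1,v_2)\in[-M;M]^2\times[a;b]^2}\left\{\frac{|X(u_1,v_1,\omega)-X(u_2,v_2,\omega)|}{|u_1-u_2|^{v_1\vee v_2-1/\alpha}+|v_1-v_2|}\right\}<\infty,$$ where $v_1\vee v_2=\max(v_1,v_2)$.
   Context: Fix $\alpha\in(1,2)$. Let $Z_\alpha(ds)$ be an independently scattered symmetric $\alpha$-stable random measure on $\mathbb{R}$ with Lebesgue control measure on $(\Omega,\mathcal{F},\mathbb{P})$. For $x,\kappa\in\mathbb{R}$, $(x)_+^\kappa=x^\kappa$ if $x>0$ and $0$ otherwise. Let $\psi$ be a three times continuously differentiable compactly supported Daubechies mother wavelet generating an orthonormal basis of $L^2(\mathbb{R})$. For $(x,v)\in\mathbb{R}\times(1/\alpha;1)$, $\Psi(x,v)=\int_{\mathbb{R}}(x-s)_+^{v-1/\alpha}\psi(s)\,ds$; for $(j,k)\in\mathbb{Z}^2$, $\epsilon_{j,k}=2^{j/\alpha}\int_{\mathbb{R}}\psi(2^js-k)Z_\alpha(ds)$. $\Omega_0^*$ is an event of probability $1$ such that for every $\eta>0$ there is a positive finite random variable $C_\eta$ with $|\epsilon_{j,k}(\omega)|\le C_\eta(\omega)(3+|j|)^{1/\alpha+\eta}(3+|k|)^{1/\alpha+\eta}$ for all $\omega\in\Omega_0^*$, $(j,k)\in\mathbb{Z}^2$.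 $\Omega_1^*$ is an event of probability $1$ such that for every $l>0$ there is a positive finite random variable $C'_l$ with $|\epsilon_{j,k}(\omega)|\le C'_l(\omega)2^{j/\alpha}$ for all $\omega\in\Omega_1^*$ and all $(j,k)\in\mathbb{Z}_+\times\mathbb{Z}$ with $|k|2^{-j}\le l$ (both events exist). $X(u,v)=\int_{\mathbb{R}}\{(u-s)_+^{v-1/\alpha}-(-s)_+^{v-1/\alpha}\}Z_\alpha(ds)$ is identified with its modification defined on $\Omega_0^*$ by $X(u,v)=\sum_{(j,k)\in\mathbb{Z}^2}2^{-jv}\epsilon_{j,k}(\Psi(2^ju-k,v)-\Psi(-k,v))$, the series converging on $\Omega_0^*$ uniformly in $(u,v)$ on compact subsets of $\mathbb{R}\times(1/\alpha;1)$. *)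

theory Defs
  imports "HOL-Analysis.Analysis"
begin

definition pospow :: "real \<Rightarrow> real \<Rightarrow> real" where
  "pospow x \<kappa> = (if x > 0 then x powr \<kappa> else 0)"

definition C3 :: "(real \<Rightarrow> real) \<Rightarrow> bool" where
  "C3 f \<longleftrightarrow> (\<forall>n<3. \<forall>x. (deriv ^^ n) f differentiable at x)
              \<and> continuous_on UNIV ((deriv ^^ 3) f)"

definition wav :: "(real \<Rightarrow> real) \<Rightarrow> int \<Rightarrow> int \<Rightarrow> real \<Rightarrow> real" where
  "wav \<psi> j k s = 2 powr (real_of_int j / 2) * \<psi> (2 powr (real_of_int j) * s - real_of_int k)"

definition wavelet_ONB :: "(real \<Rightarrow> real) \<Rightarrow> bool" where
  "wavelet_ONB \<psi> \<longleftrightarrow>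
     \<psi> \<in> borel_measurable lborel \<and>
     integrable lborel (\<lambda>s. (\<psi> s)\<^sup>2) \<and>
     (\<forall>j k j' k'. (LINT s|lborel. wav \<psi> j k s * wav \<psi> j' k' s)
                   = (if (j, k) = (j', k') then 1 else 0)) \<and>
     (\<forall>f. f \<in> borel_measurable lborel \<longrightarrow> integrable lborel (\<lambda>s. (f s)\<^sup>2) \<longrightarrow>
          (\<forall>j k. (LINT s|lborel. f s * wav \<psi> j k s) = 0) \<longrightarrow>
          (AE s in lborel. f s = 0))"

definition smooth_cs_wavelet :: "(real \<Rightarrow> real) \<Rightarrow> bool" where
  "smooth_cs_wavelet \<psi> \<longleftrightarrow> C3 \<psi> \<and> (\<exists>R. \<forall>s. \<bar>s\<bar> > R \<longrightarrow> \<psi> s = 0) \<and> wavelet_ONB \<psi>"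

definition Psi :: "real \<Rightarrow> (real \<Rightarrow> real) \<Rightarrow> real \<Rightarrow> real \<Rightarrow> real" where
  "Psi \<alpha> \<psi> x v = (LINT s|lborel. pospow (x - s) (v - 1/\<alpha>) * \<psi> s)"

text \<open>The field X(u,v) (at a fixed omega) given by the wavelet series, with coefficients
  eps j k = epsilon_{j,k}(omega).\<close>
definition Xser :: "real \<Rightarrow> (real \<Rightarrow> real) \<Rightarrow> (int \<Rightarrow> int \<Rightarrow> real) \<Rightarrow> real \<Rightarrow> real \<Rightarrow> real" where
  "Xser \<alpha> \<psi> eps u v =
     (\<Sum>\<^sub>\<infinity>(j, k)\<in>UNIV. 2 powr (- real_of_int j * v) * eps j k *
        (Psi \<alpha> \<psi> (2 powr (real_of_int j) * u - real_of_int k) v - Psi \<alpha> \<psi> (- real_of_int k) v))"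

definition in_Omega0 :: "real \<Rightarrow> (int \<Rightarrow> int \<Rightarrow> real) \<Rightarrow> bool" where
  "in_Omega0 \<alpha> eps \<longleftrightarrow> (\<forall>\<eta>>0. \<exists>C>0. \<forall>j k.
      \<bar>eps j k\<bar> \<le> C * (3 + \<bar>real_of_int j\<bar>) powr (1/\<alpha> + \<eta>) * (3 + \<bar>real_of_int k\<bar>) powr (1/\<alpha> + \<eta>))"

definition in_Omega1 :: "real \<Rightarrow> (int \<Rightarrow> int \<Rightarrow> real) \<Rightarrow> bool" where
  "in_Omega1 \<alpha> eps \<longleftrightarrow> (\<forall>l>0. \<exists>C>0. \<forall>j k. j \<ge> 0 \<longrightarrow>
      \<bar>real_of_int k\<bar> * 2 powr (- real_of_int j) \<le> l \<longrightarrow> \<bar>eps j k\<bar> \<le> C * 2 powr (real_of_int j / \<alpha>))"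

end

theory Submission
  imports Defs
begin

text \<open>
  Orthogonality to its own rescaled copies forces the wavelet to have two vanishing moments, so
  \<open>\<Psi>(x,v)\<close> and its increments in \<open>x\<close> and \<open>v\<close> decay like a power \<open>q\<close> of \<open>1/(1 + \<bar>x\<bar>)\<close>, with \<open>q\<close> large enough to sum
  the coefficients over \<open>k\<close>.  At level \<open>j \<ge> 0\<close> the increment of the series between \<open>u\<^sub>1\<close> and \<open>u\<^sub>2\<close> is then of
  order \<open>min(1, 2\<^sup>j \<bar>u\<^sub>1 - u\<^sub>2\<bar>)\<close> times \<open>2\<close> to the power \<open>-j(v - 1/\<alpha>)\<close>, with no logarithmic loss because of
  \<open>\<Omega>\<^sub>1\<close>; summation over \<open>j\<close> gives exactly the exponent \<open>v - 1/\<alpha>\<close>.  The low frequencies are Lipschitz in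
  \<open>u\<close> because \<open>v < 1\<close>.  In \<open>v\<close> the series is Lipschitz uniformly in \<open>u\<close>, so one moves from \<open>(u\<^sub>1,v\<^sub>1)\<close> to
  \<open>(u\<^sub>2,v\<^sub>2)\<close> through the level \<open>max(v\<^sub>1,v\<^sub>2)\<close>.
\<close>

section \<open>Sums over integers\<close>

text \<open>Why two moments, and where v < 1 enters: put \<kappa> = v - 1/\<alpha>. Each vanishing
  moment replaces the kernel by one more derivative, so two give decay of order 2 - \<kappa>,
  against coefficients that may grow like |k|^(1/\<alpha>). The margin is 2 - v, which exceeds 1
  exactly when v < 1; a single moment would leave 1 - v. The parameter \<delta> spends the surplus 1
  - b twice: on the logarithm created by differentiating the kernel in v, and on the extra growth of
  the coefficients in j and k. With \<Omega>_0 alone, the indices |k| of order 2^j would cost a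
  factor 2^(j \<eta>) at level j and spoil the exponent v - 1/\<alpha>. The two directions need
  different precision. In u the power of the increment must be exact, so nothing growing in j may be
  lost at j >= 0. In v only a bound uniform in u is required, and the factor |j| from
  differentiating 2^(-j v) is harmless. All estimates are made on finite partial sums; these yield
  absolute summability and the bound on the series at once.\<close>

lemma int_powr_sum_bounded:
  fixes r :: real
  assumes "r > 1"
  obtains C where "C > 0" "\<And>K :: int set. finite K \<Longrightarrow> (\<Sum>k\<in>K. (1 + \<bar>real_of_int k\<bar>) powr (-r)) \<le> C"
proof -
  define g where "g n = (1 + real n) powr (-r)" for n
  have "summable (\<lambda>n. real n powr (-r))"
    using assms by (simp add: summable_real_powr_iff)
  then have sm: "summable g"
    unfolding g_def by (subst (asm) summable_Suc_iff[symmetric]) (simp add: add.commute)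
  have nn: "g n \<ge> 0" for n by (simp add: g_def)
  \<comment> \<open>The map \<open>nat |k|\<close> is two-to-one on nonzero integers, so the
    comparison with a series over the naturals is made on sets where it is injective and used once
    per sign.\<close>
  have bd: "(\<Sum>k\<in>K. (1 + \<bar>real_of_int k\<bar>) powr (-r)) \<le> suminf g"
    if "finite K" "inj_on (\<lambda>k. nat \<bar>k\<bar>) K" for K :: "int set"
  proof -
    have "(\<Sum>k\<in>K. (1 + \<bar>real_of_int k\<bar>) powr (-r)) = sum g ((\<lambda>k. nat \<bar>k\<bar>) ` K)"
      by (subst sum.reindex[OF that(2)]) (simp add: g_def)
    also have "\<dots> \<le> suminf g"
      using that nn by (intro sum_le_suminf sm) auto
    finally show ?thesis .
  qed
  show ?thesis
  proof (rule that[of "2 * suminf g + 1"])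
    show "2 * suminf g + 1 > 0" using suminf_nonneg[OF sm nn] by simp
  next
    fix K :: "int set" assume K: "finite K"
    have "K = {k\<in>K. k \<ge> 0} \<union> {k\<in>K. k < 0}" by auto
    then have "(\<Sum>k\<in>K. (1 + \<bar>real_of_int k\<bar>) powr (-r)) =
      (\<Sum>k\<in>{k\<in>K. k \<ge> 0}. (1 + \<bar>real_of_int k\<bar>) powr (-r)) + (\<Sum>k\<in>{k\<in>K. k < 0}. (1 + \<bar>real_of_int k\<bar>) powr (-r))"
      using K by (metis (no_types, lifting) sum.union_disjoint finite_Un disjoint_iff mem_Collect_eq not_le)
    also have "\<dots> \<le> suminf g + suminf g"
      by (intro add_mono bd) (use K in \<open>auto simp: inj_on_def\<close>)
    finally show "(\<Sum>k\<in>K. (1 + \<bar>real_of_int k\<bar>) powr (-r)) \<le> 2 * suminf g + 1" by simp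
  qed
qed

text \<open>Uniformity in \<open>x\<close> is the point. Replacing \<open>x\<close> by its floor
  moves it by less than 1, so \<open>1 + |k - floor x|\<close> is at most twice
  \<open>1 + |x - k|\<close>; this costs the factor \<open>2 powr r\<close>.\<close>

lemma int_shifted_powr_sum_bounded:
  fixes r :: real
  assumes "r > 1"
  obtains C where "C > 0"
    "\<And>(K :: int set) x. finite K \<Longrightarrow> (\<Sum>k\<in>K. (1 + \<bar>x - real_of_int k\<bar>) powr (-r)) \<le> C"
proof -
  obtain C where C: "C > 0" "\<And>K :: int set. finite K \<Longrightarrow> (\<Sum>k\<in>K. (1 + \<bar>real_of_int k\<bar>) powr (-r)) \<le> C"
    using int_powr_sum_bounded[OF assms] by metis
  show ?thesis
  proof (rule that[of "2 powr r * C"])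
    show "2 powr r * C > 0" using C by simp
  next
    fix K :: "int set" and x :: real assume K: "finite K"
    have le: "(1 + \<bar>x - real_of_int k\<bar>) powr (-r) \<le> 2 powr r * (1 + \<bar>real_of_int (k - \<lfloor>x\<rfloor>)\<bar>) powr (-r)" for k
    proof -
      have "(1 + \<bar>real_of_int (k - \<lfloor>x\<rfloor>)\<bar>) / 2 \<le> 1 + \<bar>x - real_of_int k\<bar>"
        by (simp add: abs_if) linarith
      then have "(1 + \<bar>x - real_of_int k\<bar>) powr (-r) \<le> ((1 + \<bar>real_of_int (k - \<lfloor>x\<rfloor>)\<bar>) / 2) powr (-r)"
        using assms by (intro powr_mono2') auto
      also have "\<dots> = 2 powr r * (1 + \<bar>real_of_int (k - \<lfloor>x\<rfloor>)\<bar>) powr (-r)"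
        by (subst powr_divide) (auto simp: powr_minus_divide)
      finally show ?thesis .
    qed
    have "(\<Sum>k\<in>K. (1 + \<bar>x - real_of_int k\<bar>) powr (-r)) \<le>
       2 powr r * (\<Sum>k\<in>K. (1 + \<bar>real_of_int (k - \<lfloor>x\<rfloor>)\<bar>) powr (-r))"
      unfolding sum_distrib_left by (intro sum_mono le)
    also have "(\<Sum>k\<in>K. (1 + \<bar>real_of_int (k - \<lfloor>x\<rfloor>)\<bar>) powr (-r)) =
        (\<Sum>k\<in>(\<lambda>k. k - \<lfloor>x\<rfloor>) ` K. (1 + \<bar>real_of_int k\<bar>) powr (-r))"
      by (subst sum.reindex) (auto simp: inj_on_def)
    also have "\<dots> \<le> C" using K by (intro C) auto
    finally show "(\<Sum>k\<in>K. (1 + \<bar>x - real_of_int k\<bar>) powr (-r)) \<le> 2 powr r * C" by simp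
  qed
qed

text \<open>Lets a polynomial factor in the level \<open>j\<close> be absorbed by an arbitrarily
  small exponential rate. It is ln z <= z - 1 at \<open>z = (1 + y) * e\<close>, with
  \<open>e\<close> scaled so that \<open>m * e = \<rho> * ln 2\<close>.\<close>

lemma powr_le_exponential:
  fixes m \<rho> :: real
  assumes "m > 0" "\<rho> > 0"
  obtains C where "C > 0" "\<And>y. y \<ge> 0 \<Longrightarrow> (1 + y) powr m \<le> C * 2 powr (\<rho> * y)"
proof -
  define e where "e = \<rho> * ln 2 / m"
  have e: "e > 0" using assms by (simp add: e_def)
  show ?thesis
  proof (rule that[of "exp (m * e - m * ln e)"])
    fix y :: real assume y: "y \<ge> 0"
    have "ln (1 + y) + ln e = ln ((1 + y) * e)" using e y by (simp add: ln_mult)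
    also have "\<dots> \<le> (1 + y) * e - 1" using e y by (intro ln_le_minus_one) auto
    finally have "m * ln (1 + y) \<le> m * (e + y * e - ln e)"
      using assms by (intro mult_left_mono) (auto simp: algebra_simps)
    then have "(1 + y) powr m \<le> exp (m * (e + y * e - ln e))"
      using y by (simp add: powr_def)
    also have "m * (e + y * e - ln e) = (m * e - m * ln e) + \<rho> * y * ln 2"
      using assms by (simp add: e_def algebra_simps)
    finally show "(1 + y) powr m \<le> exp (m * e - m * ln e) * 2 powr (\<rho> * y)"
      by (simp add: powr_def exp_add)
  qed simp
qed

text \<open>Counting downwards from the floor of \<open>t\<close> turns the terms into powers
  \<open>x ^ n\<close> with distinct naturals \<open>n\<close>. The cut \<open>t\<close> is real
  because it will be minus the dyadic logarithm of an increment; the constant depends on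
  \<open>\<theta>\<close> alone.\<close>

lemma geometric_sum_upto:
  fixes \<theta> t :: real and J :: "int set"
  assumes "\<theta> > 0" "finite J" "\<And>j. j \<in> J \<Longrightarrow> real_of_int j \<le> t"
  shows "(\<Sum>j\<in>J. 2 powr (real_of_int j * \<theta>)) \<le> 2 powr (t * \<theta>) / (1 - 2 powr (-\<theta>))"
proof -
  define x where "x = (2::real) powr (-\<theta>)"
  have x: "0 < x" "x < 1" using assms(1) by (auto simp: x_def powr_less_one)
  have e: "2 powr (real_of_int j * \<theta>) \<le> 2 powr (t * \<theta>) * x ^ nat (\<lfloor>t\<rfloor> - j)" if "j \<in> J" for j
  proof -
    have j: "j \<le> \<lfloor>t\<rfloor>" using assms(3)[OF that] by (simp add: le_floor_iff)
    have "x ^ nat (\<lfloor>t\<rfloor> - j) = x powr (real_of_int (\<lfloor>t\<rfloor> - j))"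
      using x j by (simp flip: powr_realpow)
    also have "\<dots> = 2 powr (-\<theta> * real_of_int (\<lfloor>t\<rfloor> - j))"
      by (simp only: x_def powr_powr)
    finally have "2 powr (t * \<theta>) * x ^ nat (\<lfloor>t\<rfloor> - j) = 2 powr (t * \<theta> + -\<theta> * real_of_int (\<lfloor>t\<rfloor> - j))"
      by (simp only: powr_add)
    also have "\<dots> \<ge> 2 powr (real_of_int j * \<theta>)"
    proof (rule powr_mono)
      have "\<theta> * (t - real_of_int \<lfloor>t\<rfloor>) \<ge> 0" using assms(1) by simp
      then show "real_of_int j * \<theta> \<le> t * \<theta> + - \<theta> * real_of_int (\<lfloor>t\<rfloor> - j)"
        by (simp add: algebra_simps)
    qed simp
    finally show ?thesis .
  qed
  have inj: "inj_on (\<lambda>j. nat (\<lfloor>t\<rfloor> - j)) J"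
  proof (rule inj_onI)
    fix i j assume "i \<in> J" "j \<in> J" "nat (\<lfloor>t\<rfloor> - i) = nat (\<lfloor>t\<rfloor> - j)"
    moreover from this have "i \<le> \<lfloor>t\<rfloor>" "j \<le> \<lfloor>t\<rfloor>" using assms(3) by (auto simp: le_floor_iff)
    ultimately show "i = j" by simp
  qed
  have "(\<Sum>j\<in>J. 2 powr (real_of_int j * \<theta>)) \<le> 2 powr (t * \<theta>) * (\<Sum>j\<in>J. x ^ nat (\<lfloor>t\<rfloor> - j))"
    unfolding sum_distrib_left by (intro sum_mono e)
  also have "(\<Sum>j\<in>J. x ^ nat (\<lfloor>t\<rfloor> - j)) = (\<Sum>n\<in>(\<lambda>j. nat (\<lfloor>t\<rfloor> - j)) ` J. x ^ n)"
    by (subst sum.reindex[OF inj]) simp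
  also have "\<dots> \<le> (\<Sum>n. x ^ n)"
    using x assms(2) by (intro sum_le_suminf summable_geometric) auto
  also have "\<dots> = 1 / (1 - x)" using x by (intro suminf_geometric) auto
  finally show ?thesis by (simp add: x_def)
qed

lemma geometric_sum_from:
  fixes \<theta> t :: real and J :: "int set"
  assumes "\<theta> > 0" "finite J" "\<And>j. j \<in> J \<Longrightarrow> real_of_int j \<ge> t"
  shows "(\<Sum>j\<in>J. 2 powr (- real_of_int j * \<theta>)) \<le> 2 powr (- t * \<theta>) / (1 - 2 powr (-\<theta>))"
proof -
  have "(\<Sum>j\<in>J. 2 powr (- real_of_int j * \<theta>)) = (\<Sum>j\<in>uminus ` J. 2 powr (real_of_int j * \<theta>))"
    by (subst sum.reindex) auto
  also have "\<dots> \<le> 2 powr (- t * \<theta>) / (1 - 2 powr (-\<theta>))"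
    using assms by (intro geometric_sum_upto) auto
  finally show ?thesis .
qed

section \<open>Vanishing moments\<close>

lemma abs_integral_le_of_support:
  fixes h :: "real \<Rightarrow> real"
  assumes "R \<ge> 0" "c \<ge> 0" "\<And>s. \<bar>s\<bar> \<le> R \<Longrightarrow> \<bar>h s\<bar> \<le> c" "\<And>s. \<bar>s\<bar> > R \<Longrightarrow> h s = 0"
  shows "\<bar>LINT s|lborel. h s\<bar> \<le> 2 * R * c"
proof -
  have "\<bar>LINT s|lborel. h s\<bar> \<le> (LINT s|lborel. \<bar>h s\<bar>)"
    using integral_norm_bound[of lborel h] by simp
  also have "\<dots> \<le> (LINT s|lborel. c * indicator {-R..R} s)"
  proof (rule integral_mono')
    show "integrable lborel (\<lambda>s. c * indicator {-R..R} s)"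
      by (intro integrable_mult_right integrable_real_indicator) (auto simp: emeasure_lborel_Icc_eq)
    show "\<bar>h s\<bar> \<le> c * indicator {-R..R} s" for s
      using assms(3)[of s] assms(4)[of s] by (cases "\<bar>s\<bar> > R") (auto simp: indicator_def)
  qed (use assms in auto)
  also have "\<dots> = 2 * R * c" using assms by simp
  finally show ?thesis .
qed

lemma integrable_continuous_support:
  fixes h :: "real \<Rightarrow> real"
  assumes "continuous_on UNIV h" "\<And>s. \<bar>s\<bar> > R \<Longrightarrow> h s = 0"
  shows "integrable lborel h"
proof -
  have "set_integrable lborel {-R..R} h"
    by (rule borel_integrable_atLeastAtMost') (use assms(1) continuous_on_subset in blast)
  moreover have "(\<lambda>s. indicator {-R..R} s *\<^sub>R h s) = h"
  proof
    show "indicator {-R..R} s *\<^sub>R h s = h s" for s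
      using assms(2)[of s] by (cases "\<bar>s\<bar> > R") (auto simp: indicator_def)
  qed
  ultimately show ?thesis by (simp add: set_integrable_def)
qed

lemma deriv_zero_outside:
  fixes f :: "real \<Rightarrow> real"
  assumes "\<And>s. \<bar>s\<bar> > R \<Longrightarrow> f s = 0" "\<bar>s\<bar> > R"
  shows "deriv f s = 0"
proof -
  have "open {s::real. \<bar>s\<bar> > R}" by (intro open_Collect_less continuous_intros)
  then have "(f has_field_derivative 0) (at s)"
    using assms by (intro has_field_derivative_transform_within_open[of "\<lambda>_. 0" 0 s _ f]) auto
  then show ?thesis by (rule DERIV_imp_deriv)
qed

lemma bounded_continuous_support:
  fixes f :: "real \<Rightarrow> real"
  assumes "continuous_on UNIV f" "\<And>s. \<bar>s\<bar> > R \<Longrightarrow> f s = 0"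
  obtains S where "S > 0" "\<And>s. \<bar>f s\<bar> \<le> S"
proof -
  have "compact (f ` {-R..R})"
    using assms(1) continuous_on_subset by (intro compact_continuous_image) auto
  then obtain S where S: "\<And>y. y \<in> f ` {-R..R} \<Longrightarrow> \<bar>y\<bar> \<le> S"
    by (metis bounded_real compact_imp_bounded)
  show ?thesis
  proof (rule that[of "\<bar>S\<bar> + 1"])
    fix s show "\<bar>f s\<bar> \<le> \<bar>S\<bar> + 1"
    proof (cases "\<bar>s\<bar> > R")
      case False
      then have "\<bar>f s\<bar> \<le> S" by (intro S imageI) auto
      then show ?thesis by simp
    qed (use assms in auto)
  qed simp
qed

lemma lipschitz_of_deriv_bound:
  fixes f f' :: "real \<Rightarrow> real"
  assumes "\<And>s. (f has_real_derivative f' s) (at s)" "\<And>s. \<bar>f' s\<bar> \<le> S"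
  shows "\<bar>f x - f y\<bar> \<le> S * \<bar>x - y\<bar>"
  using field_differentiable_bound[of UNIV f f' S x y] assms
  by (auto simp: has_field_derivative_at_within)

text \<open>Compact support turns continuity into uniform bounds. The bound on the second derivative
  is exported as a Lipschitz bound for \<open>\<psi>'\<close>, the form that the first-moment
  argument uses.\<close>

lemma smooth_cs_wavelet_regularity:
  assumes "smooth_cs_wavelet \<psi>"
  obtains \<psi>' R S where "R \<ge> 0" "S > 0"
    "\<And>s. (\<psi> has_real_derivative \<psi>' s) (at s)"
    "\<And>s. \<bar>\<psi> s\<bar> \<le> S" "\<And>s. \<bar>\<psi>' s\<bar> \<le> S" "\<And>x y. \<bar>\<psi>' x - \<psi>' y\<bar> \<le> S * \<bar>x - y\<bar>"
    "\<And>s. \<bar>s\<bar> > R \<Longrightarrow> \<psi> s = 0"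
proof -
  obtain R0 where R0: "\<And>s. \<bar>s\<bar> > R0 \<Longrightarrow> \<psi> s = 0" and C3: "C3 \<psi>"
    using assms by (auto simp: smooth_cs_wavelet_def)
  define R where "R = max R0 0"
  have R: "\<And>s. \<bar>s\<bar> > R \<Longrightarrow> \<psi> s = 0" using R0 by (simp add: R_def)
  have diff: "(deriv ^^ n) \<psi> differentiable at x" if "n < 3" for n x
    using C3 that by (simp add: C3_def)
  define d1 where "d1 = deriv \<psi>"
  define d2 where "d2 = deriv d1"
  have D0: "(\<psi> has_real_derivative d1 s) (at s)" for s
    using diff[of 0 s] by (simp add: d1_def DERIV_deriv_iff_real_differentiable)
  have D1: "(d1 has_real_derivative d2 s) (at s)" for s
    using diff[of 1 s] by (simp add: d1_def d2_def DERIV_deriv_iff_real_differentiable)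
  have "d2 differentiable at s" for s
    using diff[of 2 s] by (simp add: d1_def d2_def numeral_2_eq_2)
  then have c2: "continuous_on UNIV d2"
    by (intro differentiable_imp_continuous_on) (simp add: differentiable_on_def)
  have c0: "continuous_on UNIV \<psi>"
    by (rule DERIV_continuous_on) (rule has_field_derivative_at_within[OF D0])
  have c1: "continuous_on UNIV d1"
    by (rule DERIV_continuous_on) (rule has_field_derivative_at_within[OF D1])
  have z1: "\<And>s. \<bar>s\<bar> > R \<Longrightarrow> d1 s = 0" unfolding d1_def using R by (rule deriv_zero_outside)
  have z2: "\<And>s. \<bar>s\<bar> > R \<Longrightarrow> d2 s = 0" unfolding d2_def using z1 by (rule deriv_zero_outside)
  obtain S0 where S0: "S0 > 0" "\<And>s. \<bar>\<psi> s\<bar> \<le> S0" using bounded_continuous_support[OF c0 R] by metis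
  obtain S1 where S1: "S1 > 0" "\<And>s. \<bar>d1 s\<bar> \<le> S1" using bounded_continuous_support[OF c1 z1] by metis
  obtain S2 where S2: "S2 > 0" "\<And>s. \<bar>d2 s\<bar> \<le> S2" using bounded_continuous_support[OF c2 z2] by metis
  define S where "S = max S0 (max S1 S2)"
  have S: "S0 \<le> S" "S1 \<le> S" "S2 \<le> S" by (auto simp: S_def)
  show ?thesis
  proof (rule that[of R S d1])
    show "\<bar>d1 x - d1 y\<bar> \<le> S * \<bar>x - y\<bar>" for x y
      by (rule lipschitz_of_deriv_bound[OF D1 order_trans[OF S2(2) S(3)]])
    show "\<bar>\<psi> s\<bar> \<le> S" for s using S0(2) S(1) by (rule order_trans)
    show "\<bar>d1 s\<bar> \<le> S" for s using S1(2) S(2) by (rule order_trans)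
    show "S > 0" using S0(1) S(1) by linarith
    show "R \<ge> 0" by (simp add: R_def)
  qed (rule D0 R; assumption?)+
qed

text \<open>The substitution \<open>s = (y + k) / 2^j\<close> brings the finer wavelet to scale 1
  and stretches the other one, which becomes nearly constant on the support of \<open>\<psi>\<close>
  and can be expanded there.\<close>

lemma wavelet_orthogonal_to_finer:
  assumes "wavelet_ONB \<psi>" "j > 0"
  shows "(LINT y|lborel. \<psi> ((y + real_of_int k) * 2 powr (- real_of_int j)) * \<psi> y) = 0"
proof -
  define c where "c = (2::real) powr (real_of_int j)"
  have c: "c > 0" by (simp add: c_def)
  have "(LINT s|lborel. wav \<psi> 0 0 s * wav \<psi> j k s) = 0"
    using assms by (simp add: wavelet_ONB_def)
  moreover have "wav \<psi> 0 0 s * wav \<psi> j k s = 2 powr (real_of_int j / 2) * (\<psi> s * \<psi> (c * s - k))" for s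
    by (simp add: wav_def c_def)
  ultimately have z: "(LINT s|lborel. \<psi> s * \<psi> (c * s - k)) = 0" by simp
  have "(LINT s|lborel. \<psi> s * \<psi> (c * s - k)) =
      \<bar>1/c\<bar> *\<^sub>R (LINT y|lborel. \<psi> (k/c + (1/c) * y) * \<psi> (c * (k/c + (1/c) * y) - k))"
    using c by (intro lborel_integral_real_affine) auto
  also have "(LINT y|lborel. \<psi> (k/c + (1/c) * y) * \<psi> (c * (k/c + (1/c) * y) - k)) =
    (LINT y|lborel. \<psi> ((y + real_of_int k) * 2 powr (- real_of_int j)) * \<psi> y)"
  proof (rule Bochner_Integration.integral_cong)
    fix y :: real
    have "k/c + (1/c) * y = (y + k) * 2 powr (- real_of_int j)"
      by (simp add: c_def powr_minus field_simps)
    moreover have "c * (k/c + (1/c) * y) - k = y" using c by (simp add: field_simps)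
    ultimately show "\<psi> (k/c + (1/c) * y) * \<psi> (c * (k/c + (1/c) * y) - k) =
       \<psi> ((y + real_of_int k) * 2 powr (- real_of_int j)) * \<psi> y" by simp
  qed simp
  finally show ?thesis using z c by simp
qed

lemma zero_if_le_all_powers:
  fixes x C :: real
  assumes "\<And>n. n > 0 \<Longrightarrow> \<bar>x\<bar> \<le> C * 2 powr (- real n)"
  shows "x = 0"
proof -
  have "(\<lambda>n. C * (1/2::real) ^ n) \<longlonglongrightarrow> C * 0"
    by (intro tendsto_intros LIMSEQ_power_zero) auto
  then have "(\<lambda>n. C * 2 powr (- real n)) \<longlonglongrightarrow> C * 0"
    by (simp add: powr_minus powr_realpow power_one_over inverse_eq_divide)
  then have "\<bar>x\<bar> \<le> C * 0"
    by (rule LIMSEQ_le_const) (use assms in \<open>auto intro!: exI[of _ 1]\<close>)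
  then show ?thesis by simp
qed

text \<open>Let \<open>n \<rightarrow> \<infinity>\<close> in the orthogonality of \<open>\<psi>\<close> to its copies at scale \<open>2\<^sup>-\<^sup>n\<close>
  located near a point \<open>x\<close>: the leading term is \<open>\<psi> x\<close> times the zeroth moment and, once that moment is
  known to vanish, \<open>\<psi>' x\<close> times the first moment.\<close>

lemma wavelet_vanishing_moments:
  assumes "smooth_cs_wavelet \<psi>"
  shows "(LINT s|lborel. \<psi> s) = 0" "(LINT s|lborel. s * \<psi> s) = 0"
proof -
  obtain \<psi>' R S where R: "R \<ge> 0" and S: "S > 0"
    and D: "\<And>s. (\<psi> has_real_derivative \<psi>' s) (at s)"
    and B: "\<And>s. \<bar>\<psi> s\<bar> \<le> S" and B': "\<And>s. \<bar>\<psi>' s\<bar> \<le> S" and L': "\<And>x y. \<bar>\<psi>' x - \<psi>' y\<bar> \<le> S * \<bar>x - y\<bar>"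
    and Z: "\<And>s. \<bar>s\<bar> > R \<Longrightarrow> \<psi> s = 0"
    using smooth_cs_wavelet_regularity[OF assms] by metis
  have onb: "wavelet_ONB \<psi>" using assms by (simp add: smooth_cs_wavelet_def)
  have c: "continuous_on UNIV \<psi>"
    by (rule DERIV_continuous_on) (rule has_field_derivative_at_within[OF D])
  note [continuous_intros] = continuous_on_compose2[OF c _ subset_UNIV]
  have L: "\<bar>\<psi> x - \<psi> y\<bar> \<le> S * \<bar>x - y\<bar>" for x y
    by (rule lipschitz_of_deriv_bound[OF D B'])
  \<comment> \<open>The dyadic point of scale \<open>2 powr (- real n)\<close> just left of
    \<open>x\<close>; its numerator is the translation index of the fine wavelet located
    there.\<close>
  define pt where "pt x n = real_of_int \<lfloor>2 ^ n * x\<rfloor> * 2 powr (- real n)" for x :: real and n :: nat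
  have pt: "\<bar>pt x n - x\<bar> \<le> 2 powr (- real n)" for x n
  proof -
    have "x = (2 ^ n * x) * 2 powr (- real n)" by (simp add: powr_minus powr_realpow)
    then have "pt x n - x = (real_of_int \<lfloor>2 ^ n * x\<rfloor> - 2 ^ n * x) * 2 powr (- real n)"
      by (simp add: pt_def algebra_simps)
    also have "\<bar>\<dots>\<bar> = \<bar>real_of_int \<lfloor>2 ^ n * x\<rfloor> - 2 ^ n * x\<bar> * 2 powr (- real n)"
      by (simp add: abs_mult)
    also have "\<dots> \<le> 1 * 2 powr (- real n)"
      by (intro mult_right_mono) (auto simp: abs_le_iff, linarith)
    finally show ?thesis by simp
  qed
  have orth: "(LINT y|lborel. \<psi> (pt x n + y * 2 powr (- real n)) * \<psi> y) = 0" if "n > 0" for x n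
    using wavelet_orthogonal_to_finer[OF onb, of "int n" "\<lfloor>2 ^ n * x\<rfloor>"] that
    by (simp add: pt_def algebra_simps)
  have int: "integrable lborel (\<lambda>y. h y * \<psi> y)" if "continuous_on UNIV h" for h
    by (rule integrable_continuous_support[of _ R]) (intro continuous_intros that, simp add: Z)
  have dist: "\<bar>pt x n + y * 2 powr (- real n) - x\<bar> \<le> (1 + R) * 2 powr (- real n)" if "\<bar>y\<bar> \<le> R" for x n y
  proof -
    have "\<bar>y * 2 powr (- real n)\<bar> \<le> R * 2 powr (- real n)"
      using that by (simp add: abs_mult mult_right_mono)
    then show ?thesis using pt[of x n] by (simp add: algebra_simps)
  qed
  show m0: "(LINT s|lborel. \<psi> s) = 0"
  proof -
    have "\<psi> x * (LINT s|lborel. \<psi> s) = 0" for x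
    proof (rule zero_if_le_all_powers)
      fix n :: nat assume n: "n > 0"
      \<comment> \<open>The subtracted integral is zero by orthogonality, so only the variation of
        \<open>\<psi>\<close> over a distance of order 2^(-n) remains.\<close>
      have "\<psi> x * (LINT s|lborel. \<psi> s) = (LINT y|lborel. \<psi> x * \<psi> y) - (LINT y|lborel. \<psi> (pt x n + y * 2 powr (- real n)) * \<psi> y)"
        using orth[OF n] by simp
      also have "\<dots> = (LINT y|lborel. (\<psi> x - \<psi> (pt x n + y * 2 powr (- real n))) * \<psi> y)"
        unfolding left_diff_distrib
        by (rule Bochner_Integration.integral_diff[symmetric]; rule int; intro continuous_intros)
      also have "\<bar>\<dots>\<bar> \<le> 2 * R * (S * ((1 + R) * 2 powr (- real n)) * S)"
      proof (rule abs_integral_le_of_support)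
        fix y assume y: "\<bar>y\<bar> \<le> R"
        have "\<bar>\<psi> x - \<psi> (pt x n + y * 2 powr (- real n))\<bar> \<le> S * \<bar>x - (pt x n + y * 2 powr (- real n))\<bar>"
          by (rule L)
        also have "\<dots> \<le> S * ((1 + R) * 2 powr (- real n))"
          using S dist[OF y, of x n] by (intro mult_left_mono) (auto simp: abs_minus_commute)
        finally show "\<bar>(\<psi> x - \<psi> (pt x n + y * 2 powr (- real n))) * \<psi> y\<bar> \<le> S * ((1 + R) * 2 powr (- real n)) * S"
          unfolding abs_mult by (rule mult_mono) (use S R B in auto)
      qed (use R S Z in auto)
      finally show "\<bar>\<psi> x * (LINT s|lborel. \<psi> s)\<bar> \<le> (2 * R * S * (1 + R) * S) * 2 powr (- real n)"
        by (simp add: algebra_simps)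
    qed
    moreover have "\<exists>x. \<psi> x \<noteq> 0"
    proof (rule ccontr)
      assume "\<not> (\<exists>x. \<psi> x \<noteq> 0)"
      then have "(LINT s|lborel. wav \<psi> 0 0 s * wav \<psi> 0 0 s) = 0" by (simp add: wav_def)
      then show False using onb by (simp add: wavelet_ONB_def)
    qed
    ultimately show ?thesis by auto
  qed
  show "(LINT s|lborel. s * \<psi> s) = 0"
  proof -
    have "\<psi>' x * (LINT s|lborel. s * \<psi> s) = 0" for x
    proof (rule zero_if_le_all_powers)
      fix n :: nat assume n: "n > 0"
      \<comment> \<open>The first moment enters at order \<open>e\<close>, so the remainder must be
        of order e^2 before \<open>e\<close> is divided out. The term with
        \<open>\<psi> (pt x n)\<close> is free since the zeroth moment vanishes.\<close>
      define e where "e = (2::real) powr (- real n)"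
      have e: "e > 0" by (simp add: e_def)
      have "e * (\<psi>' x * (LINT s|lborel. s * \<psi> s)) =
        (LINT y|lborel. (\<psi>' x * e * y) * \<psi> y) + (LINT y|lborel. \<psi> (pt x n) * \<psi> y) - (LINT y|lborel. \<psi> (pt x n + y * e) * \<psi> y)"
        using orth[OF n, of x] m0 by (simp add: e_def mult.assoc)
      also have "\<dots> = (LINT y|lborel. (\<psi>' x * e * y + \<psi> (pt x n) - \<psi> (pt x n + y * e)) * \<psi> y)"
        unfolding left_diff_distrib distrib_right
        by (subst Bochner_Integration.integral_diff Bochner_Integration.integral_add;
            (intro Bochner_Integration.integrable_add int continuous_intros)?)+ simp
      also have "\<bar>\<dots>\<bar> \<le> 2 * R * (S * ((1 + R) * e) * (R * e) * S)"
      proof (rule abs_integral_le_of_support)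
        fix y assume y: "\<bar>y\<bar> \<le> R"
        \<comment> \<open>On \<open>A\<close> the derivative stays within
          \<open>S * ((1 + R) * e)\<close> of \<open>\<psi>' x\<close>. Hence the slope can be taken
          at the fixed point \<open>x\<close> although the expansion starts at
          \<open>pt x n\<close>.\<close>
        define A where "A = {x - (1 + R) * e..x + (1 + R) * e}"
        have b: "\<bar>(\<psi> t - \<psi>' x * t) - (\<psi> t' - \<psi>' x * t')\<bar> \<le> S * ((1 + R) * e) * \<bar>t - t'\<bar>" if "t \<in> A" "t' \<in> A" for t t'
        proof -
          have "norm ((\<psi> t - \<psi>' x * t) - (\<psi> t' - \<psi>' x * t')) \<le> S * ((1 + R) * e) * norm (t - t')"
          proof (rule field_differentiable_bound[of A _ "\<lambda>t. \<psi>' t - \<psi>' x"])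
            show "((\<lambda>t. \<psi> t - \<psi>' x * t) has_field_derivative \<psi>' s - \<psi>' x) (at s within A)" for s
              by (auto intro!: derivative_eq_intros has_field_derivative_at_within[OF D])
            show "norm (\<psi>' s - \<psi>' x) \<le> S * ((1 + R) * e)" if "s \<in> A" for s
            proof -
              have "\<bar>\<psi>' s - \<psi>' x\<bar> \<le> S * \<bar>s - x\<bar>" by (rule L')
              also have "\<dots> \<le> S * ((1 + R) * e)"
                using that S by (intro mult_left_mono) (auto simp: A_def abs_le_iff)
              finally show ?thesis by simp
            qed
          qed (use that in \<open>auto simp: A_def\<close>)
          then show ?thesis by simp
        qed
        have "pt x n + y * e \<in> A" "pt x n \<in> A"
          using dist[OF y, of x n] dist[of 0 x n] R by (auto simp: A_def abs_le_iff e_def)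
        from b[OF this(2,1)] have "\<bar>\<psi>' x * e * y + \<psi> (pt x n) - \<psi> (pt x n + y * e)\<bar> \<le> S * ((1 + R) * e) * \<bar>y * e\<bar>"
          by (simp add: algebra_simps)
        also have "\<dots> \<le> S * ((1 + R) * e) * (R * e)"
          using S e R y by (intro mult_left_mono) (auto simp: abs_mult)
        finally show "\<bar>(\<psi>' x * e * y + \<psi> (pt x n) - \<psi> (pt x n + y * e)) * \<psi> y\<bar> \<le> S * ((1 + R) * e) * (R * e) * S"
          unfolding abs_mult by (rule mult_mono) (use S R B e in auto)
      qed (use R S Z e in auto)
      finally have "e * \<bar>\<psi>' x * (LINT s|lborel. s * \<psi> s)\<bar> \<le> e * ((2 * R * S * (1 + R) * R * S) * e)"
        using e by (simp add: mult_ac abs_mult)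
      then show "\<bar>\<psi>' x * (LINT s|lborel. s * \<psi> s)\<bar> \<le> (2 * R * S * (1 + R) * R * S) * 2 powr (- real n)"
        using e by (simp add: e_def)
    qed
    moreover have "\<exists>x. \<psi>' x \<noteq> 0"
    proof (rule ccontr)
      assume *: "\<not> (\<exists>x. \<psi>' x \<noteq> 0)"
      have "\<bar>\<psi> x - \<psi> (R + 1)\<bar> \<le> 0 * \<bar>x - (R + 1)\<bar>" for x
        by (rule lipschitz_of_deriv_bound[OF D]) (use * in auto)
      then have "\<psi> x = 0" for x using Z[of "R + 1"] R by simp
      then have "(LINT s|lborel. wav \<psi> 0 0 s * wav \<psi> 0 0 s) = 0" by (simp add: wav_def)
      then show False using onb by (simp add: wavelet_ONB_def)
    qed
    ultimately show ?thesis by auto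
  qed
qed

section \<open>Decay of the fractional primitives of the wavelet\<close>

text \<open>For large \<open>x\<close>, the two vanishing moments of \<open>g\<close> cancel the first-order Taylor polynomial of \<open>f\<close> at \<open>x\<close>,
  so only the second derivative of the kernel contributes.\<close>

lemma kernel_decay:
  fixes f f' f'' g :: "real \<Rightarrow> real"
  assumes R: "R \<ge> 0" and q: "q > 0" and K: "K \<ge> 0" and S: "S \<ge> 0"
    and cf: "continuous_on UNIV f" and cg: "continuous_on UNIV g"
    and f0: "\<And>t. t \<le> 0 \<Longrightarrow> f t = 0"
    and fK: "\<And>t. 0 < t \<Longrightarrow> t \<le> 3 * R + 1 \<Longrightarrow> \<bar>f t\<bar> \<le> K"
    and D1: "\<And>t. t > 0 \<Longrightarrow> (f has_real_derivative f' t) (at t)"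
    and D2: "\<And>t. t > 0 \<Longrightarrow> (f' has_real_derivative f'' t) (at t)"
    and f2K: "\<And>t. t \<ge> 1 \<Longrightarrow> \<bar>f'' t\<bar> \<le> K * t powr (-q)"
    and gS: "\<And>s. \<bar>g s\<bar> \<le> S" and g0: "\<And>s. \<bar>s\<bar> > R \<Longrightarrow> g s = 0"
    and m0: "(LINT s|lborel. g s) = 0" and m1: "(LINT s|lborel. s * g s) = 0"
  shows "\<bar>LINT s|lborel. f (x - s) * g s\<bar>
     \<le> (2 * R * (2 * R + 2) powr q + 2 * R ^ 3 * 2 powr q) * K * S * (1 + \<bar>x\<bar>) powr (-q)"
proof -
  note [continuous_intros] = continuous_on_compose2[OF cf _ subset_UNIV] cg
  define w where "w = (1 + \<bar>x\<bar>) powr (-q)"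
  have w: "w > 0" by (simp add: w_def)
  have int: "integrable lborel (\<lambda>s. h s * g s)" if "continuous_on UNIV h" for h
    by (rule integrable_continuous_support[of _ R]) (intro continuous_intros that, simp add: g0)
  \<comment> \<open>Left of the support the kernel is zero. Beyond \<open>2 * R + 1\<close> the
    whole interval \<open>[x - R, x + R]\<close> lies above both 1 and \<open>(1 + x) / 2\<close>,
    so the second derivative is of size \<open>(1 + x) powr (-q)\<close> there. In between,
    \<open>x - s\<close> is at most \<open>3 * R + 1\<close>, which explains the range in
    \<open>fK\<close>.\<close>
  consider "x < - R" | "- R \<le> x" "x \<le> 2 * R + 1" | "x > 2 * R + 1" by linarith
  then show ?thesis
  proof cases
    case 1
    have "f (x - s) * g s = 0" for s
      using 1 f0[of "x - s"] g0[of s] by (cases "\<bar>s\<bar> > R") auto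
    then have "(LINT s|lborel. f (x - s) * g s) = 0" by (simp only:) simp
    then show ?thesis using R K S by simp
  next
    case 2
    have "\<bar>LINT s|lborel. f (x - s) * g s\<bar> \<le> 2 * R * (K * S)"
    proof (rule abs_integral_le_of_support)
      fix s assume s: "\<bar>s\<bar> \<le> R"
      have "\<bar>f (x - s)\<bar> \<le> K"
        using f0[of "x - s"] fK[of "x - s"] K s 2 by (cases "x - s > 0") auto
      then show "\<bar>f (x - s) * g s\<bar> \<le> K * S"
        unfolding abs_mult using gS[of s] K by (intro mult_mono) auto
    qed (use R K S g0 in auto)
    also have "1 \<le> (2 * R + 2) powr q * w"
    proof -
      have "(1 + \<bar>x\<bar>) powr q \<le> (2 * R + 2) powr q"
        using 2 R q by (intro powr_mono2) auto
      then show ?thesis by (simp add: w_def powr_minus field_simps)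
    qed
    then have "2 * R * (K * S) * 1 \<le> 2 * R * (K * S) * ((2 * R + 2) powr q * w)"
      using R K S by (intro mult_left_mono) auto
    then have "2 * R * (K * S) \<le> (2 * R * (2 * R + 2) powr q) * (K * S * w)"
      by (simp add: mult_ac)
    also have "\<dots> \<le> (2 * R * (2 * R + 2) powr q + 2 * R ^ 3 * 2 powr q) * (K * S * w)"
      using R K S w by (intro mult_right_mono) auto
    finally show ?thesis by (simp add: w_def mult_ac)
  next
    case 3
    have "(LINT s|lborel. f (x - s) * g s) =
       (LINT s|lborel. f (x - s) * g s) - (LINT s|lborel. f x * g s) + (LINT s|lborel. f' x * s * g s)"
      using m0 m1 by (simp add: mult.assoc)
    also have "\<dots> = (LINT s|lborel. (f (x - s) - f x + f' x * s) * g s)"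
      unfolding left_diff_distrib distrib_right
      by (subst Bochner_Integration.integral_add Bochner_Integration.integral_diff;
          (intro Bochner_Integration.integrable_diff int continuous_intros)?)+ simp
    also have "\<bar>\<dots>\<bar> \<le> 2 * R * ((K * (2 powr q * w) * R * R) * S)"
    proof (rule abs_integral_le_of_support)
      fix s assume s: "\<bar>s\<bar> \<le> R"
      define A where "A = {x - R..x + R}"
      have A: "t > 0" "t \<ge> 1" "t \<ge> (1 + x) / 2" if "t \<in> A" for t
        using that 3 R by (auto simp: A_def)
      have f2: "\<bar>f'' t\<bar> \<le> K * (2 powr q * w)" if "t \<in> A" for t
      proof -
        have "\<bar>f'' t\<bar> \<le> K * t powr (-q)" using A that by (intro f2K) auto
        also have "t powr (-q) \<le> ((1 + x) / 2) powr (-q)"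
          using A[OF that] 3 R q by (intro powr_mono2') auto
        also have "\<dots> = 2 powr q * w"
          using 3 R by (subst powr_divide) (auto simp: w_def powr_minus_divide)
        finally show ?thesis using K by (simp add: mult_left_mono)
      qed
      have x: "x \<in> A" "x - s \<in> A" using s R by (auto simp: A_def)
      \<comment> \<open>Taylor's remainder is replaced by two mean value bounds: first for
        \<open>f'\<close>, then for \<open>f\<close> minus its linear part.\<close>
      have f1: "\<bar>f' t - f' x\<bar> \<le> K * (2 powr q * w) * R" if "t \<in> A" for t
      proof -
        have "norm (f' t - f' x) \<le> K * (2 powr q * w) * norm (t - x)"
          by (rule field_differentiable_bound[of A])
             (use that x f2 A in \<open>auto intro!: has_field_derivative_at_within[OF D2] simp: A_def\<close>)
        also have "\<dots> \<le> K * (2 powr q * w) * R"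
          using that K w by (intro mult_left_mono) (auto simp: A_def)
        finally show ?thesis by simp
      qed
      have "norm ((f (x - s) - f' x * (x - s)) - (f x - f' x * x)) \<le> K * (2 powr q * w) * R * norm ((x - s) - x)"
      proof (rule field_differentiable_bound[of A _ "\<lambda>t. f' t - f' x"])
        show "((\<lambda>t. f t - f' x * t) has_field_derivative f' t - f' x) (at t within A)" if "t \<in> A" for t
          by (auto intro!: derivative_eq_intros has_field_derivative_at_within[OF D1] A that)
      qed (use x f1 in \<open>auto simp: A_def\<close>)
      also have "\<dots> \<le> K * (2 powr q * w) * R * R"
        using s K w R by (intro mult_left_mono) auto
      finally have "\<bar>f (x - s) - f x + f' x * s\<bar> \<le> K * (2 powr q * w) * R * R"
        by (simp add: algebra_simps)
      then show "\<bar>(f (x - s) - f x + f' x * s) * g s\<bar> \<le> (K * (2 powr q * w) * R * R) * S"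
        unfolding abs_mult using gS[of s] K w R by (intro mult_mono) auto
    qed (use R K S w g0 in auto)
    also have "\<dots> = (2 * R ^ 3 * 2 powr q) * (K * S * w)"
      by (simp add: power3_eq_cube mult_ac)
    also have "\<dots> \<le> (2 * R * (2 * R + 2) powr q + 2 * R ^ 3 * 2 powr q) * (K * S * w)"
      using R K S w by (intro mult_right_mono) auto
    finally show ?thesis by (simp add: w_def mult_ac)
  qed
qed

text \<open>Carrying the weights of both endpoints keeps the Lipschitz clause meaningful for distant
  points and avoids comparing the two weights. One constant scales both clauses, so increments in
  \<open>v\<close> can be covered by \<open>A * |v - v'|\<close>.\<close>

definition decay_lip :: "real \<Rightarrow> real \<Rightarrow> (real \<Rightarrow> real) \<Rightarrow> bool" where
  "decay_lip q A P \<longleftrightarrow>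
     (\<forall>x. \<bar>P x\<bar> \<le> A * (1 + \<bar>x\<bar>) powr (-q)) \<and>
     (\<forall>x y. \<bar>P x - P y\<bar> \<le> A * \<bar>x - y\<bar> * ((1 + \<bar>x\<bar>) powr (-q) + (1 + \<bar>y\<bar>) powr (-q)))"

text \<open>For \<open>\<bar>h\<bar> \<le> 1\<close>, the Lipschitz estimate is the decay estimate applied to \<open>g s = \<psi> s - \<psi> (s - h)\<close>, which again has two
  vanishing moments and is bounded by a multiple of \<open>\<bar>h\<bar>\<close>; no differentiation under the integral is needed.\<close>

lemma kernel_decay_lip:
  fixes f f' f'' \<psi> \<psi>' :: "real \<Rightarrow> real" and R q :: real
  defines "c \<equiv> 2 * (R + 1) * (2 * (R + 1) + 2) powr q + 2 * (R + 1) ^ 3 * 2 powr q"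
  assumes R: "R \<ge> 0" and q: "q > 0" and K: "K \<ge> 0" and S: "S \<ge> 0"
    and cf: "continuous_on UNIV f"
    and f0: "\<And>t. t \<le> 0 \<Longrightarrow> f t = 0"
    and fK: "\<And>t. 0 < t \<Longrightarrow> t \<le> 3 * (R + 1) + 1 \<Longrightarrow> \<bar>f t\<bar> \<le> K"
    and D1: "\<And>t. t > 0 \<Longrightarrow> (f has_real_derivative f' t) (at t)"
    and D2: "\<And>t. t > 0 \<Longrightarrow> (f' has_real_derivative f'' t) (at t)"
    and f2K: "\<And>t. t \<ge> 1 \<Longrightarrow> \<bar>f'' t\<bar> \<le> K * t powr (-q)"
    and D: "\<And>s. (\<psi> has_real_derivative \<psi>' s) (at s)"
    and gS: "\<And>s. \<bar>\<psi> s\<bar> \<le> S" and g'S: "\<And>s. \<bar>\<psi>' s\<bar> \<le> S" and g0: "\<And>s. \<bar>s\<bar> > R \<Longrightarrow> \<psi> s = 0"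
    and m0: "(LINT s|lborel. \<psi> s) = 0" and m1: "(LINT s|lborel. s * \<psi> s) = 0"
  shows "decay_lip q (c * K * S) (\<lambda>x. LINT s|lborel. f (x - s) * \<psi> s)"
proof -
  define P where "P x = (LINT s|lborel. f (x - s) * \<psi> s)" for x
  define w where "w x = (1 + \<bar>x\<bar>) powr (-q)" for x :: real
  have w: "w x > 0" for x by (simp add: w_def)
  \<comment> \<open>\<open>c\<close> is the constant of \<open>kernel_decay\<close> for radius
    \<open>R + 1\<close>, which contains the support of \<open>\<psi>\<close> and of all its shifts
    by at most 1.\<close>
  have R1: "R + 1 \<ge> 0" using R by simp
  have c: "c \<ge> 0" using R by (simp add: c_def)
  have cg: "continuous_on UNIV \<psi>"
    by (rule DERIV_continuous_on) (rule has_field_derivative_at_within[OF D])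
  note [continuous_intros] = continuous_on_compose2[OF cf _ subset_UNIV] continuous_on_compose2[OF cg _ subset_UNIV]
  have int: "integrable lborel (\<lambda>s. h s * \<psi> (s - a))" if "continuous_on UNIV h" for h a
    by (rule integrable_continuous_support[of _ "R + \<bar>a\<bar>"]) (intro continuous_intros that, simp add: g0)
  have dec: "\<bar>LINT s|lborel. f (x - s) * g s\<bar> \<le> c * K * S' * w x"
    if "S' \<ge> 0" "continuous_on UNIV g" "\<And>s. \<bar>g s\<bar> \<le> S'" "\<And>s. \<bar>s\<bar> > R + 1 \<Longrightarrow> g s = 0"
       "(LINT s|lborel. g s) = 0" "(LINT s|lborel. s * g s) = 0" for g S' x
    unfolding c_def w_def using kernel_decay[OF R1 q K that(1) cf that(2) f0 fK D1 D2 f2K that(3-6)] .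
  have bd: "\<bar>P x\<bar> \<le> c * K * S * w x" for x
    unfolding P_def by (rule dec[OF S cg gS _ m0 m1]) (use g0 in auto)
  have shift: "(LINT s|lborel. F s * \<psi> (s - h)) = (LINT s|lborel. F (s + h) * \<psi> s)" for F h
    using lborel_integral_real_affine[of 1 "\<lambda>s. F s * \<psi> (s - h)" h] by (simp add: add.commute)
  have lip: "\<bar>P x - P y\<bar> \<le> c * K * S * \<bar>x - y\<bar> * (w x + w y)" for x y
  proof (cases "\<bar>x - y\<bar> \<ge> 1")
    case True
    have "\<bar>P x - P y\<bar> \<le> c * K * S * 1 * (w x + w y)"
      using bd[of x] bd[of y] by (simp add: algebra_simps)
    also have "\<dots> \<le> c * K * S * \<bar>x - y\<bar> * (w x + w y)"
      using True w[of x] w[of y] c K S by (intro mult_left_mono mult_right_mono) auto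
    finally show ?thesis .
  next
    case False
    define h where "h = x - y"
    have h: "\<bar>h\<bar> \<le> 1" using False by (simp add: h_def)
    \<comment> \<open>Translation moves the increment from the kernel, merely continuous at 0, onto
      the smooth wavelet.\<close>
    have "P y = (LINT s|lborel. f (x - s) * \<psi> (s - h))"
      unfolding shift P_def by (simp add: h_def algebra_simps)
    then have "P x - P y = (LINT s|lborel. f (x - s) * \<psi> s - f (x - s) * \<psi> (s - h))"
      unfolding P_def using int[of "\<lambda>s. f (x - s)" 0] int[of "\<lambda>s. f (x - s)" h]
      by (simp add: continuous_intros)
    also have "\<dots> = (LINT s|lborel. f (x - s) * (\<psi> s - \<psi> (s - h)))"
      by (simp add: algebra_simps)
    also have "\<bar>\<dots>\<bar> \<le> c * K * (S * \<bar>h\<bar>) * w x"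
    proof (rule dec)
      show "continuous_on UNIV (\<lambda>s. \<psi> s - \<psi> (s - h))" by (intro continuous_intros)
      show "\<bar>\<psi> s - \<psi> (s - h)\<bar> \<le> S * \<bar>h\<bar>" for s
        using lipschitz_of_deriv_bound[OF D g'S, of s "s - h"] by simp
      show "\<psi> s - \<psi> (s - h) = 0" if "\<bar>s\<bar> > R + 1" for s
      proof -
        have "\<bar>s\<bar> > R" "\<bar>s - h\<bar> > R" using that h by linarith+
        then show ?thesis by (simp add: g0)
      qed
      have i: "integrable lborel \<psi>" "integrable lborel (\<lambda>s. \<psi> (s - h))"
         "integrable lborel (\<lambda>s. s * \<psi> s)" "integrable lborel (\<lambda>s. s * \<psi> (s - h))"
        using int[of "\<lambda>_. 1" 0] int[of "\<lambda>_. 1" h] int[of "\<lambda>s. s" 0] int[of "\<lambda>s. s" h]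
        by (simp_all add: continuous_on_id)
      show "(LINT s|lborel. \<psi> s - \<psi> (s - h)) = 0"
        using i shift[of "\<lambda>_. 1" h] m0 by simp
      show "(LINT s|lborel. s * (\<psi> s - \<psi> (s - h))) = 0"
        using i shift[of "\<lambda>s. s" h] m0 m1 by (simp add: right_diff_distrib distrib_right)
    qed (use S in auto)
    also have "\<dots> = c * K * S * \<bar>h\<bar> * w x" by simp
    also have "\<dots> \<le> c * K * S * \<bar>h\<bar> * (w x + w y)"
      using w[of y] c K S by (intro mult_left_mono) auto
    finally show ?thesis by (simp add: h_def)
  qed
  show ?thesis
    using bd lip by (simp add: decay_lip_def w_def P_def)
qed

section \<open>Truncated powers and their dependence on the exponent\<close>

lemma continuous_on_pospow:
  assumes "\<kappa> > 0"
  shows "continuous_on UNIV (\<lambda>t. pospow t \<kappa>)"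
proof -
  have "continuous_on UNIV (\<lambda>t::real. max t 0 powr \<kappa>)"
    by (intro continuous_on_powr') (use assms in \<open>auto intro!: continuous_intros\<close>)
  moreover have "(\<lambda>t. pospow t \<kappa>) = (\<lambda>t. max t 0 powr \<kappa>)"
    by (auto simp: pospow_def fun_eq_iff max_def)
  ultimately show ?thesis by (simp only:)
qed

lemma has_derivative_pospow:
  assumes "t > 0"
  shows "((\<lambda>t. pospow t \<kappa>) has_real_derivative \<kappa> * t powr (\<kappa> - 1)) (at t)"
  by (rule has_field_derivative_transform_within_open[of "\<lambda>t. t powr \<kappa>" _ t "{0<..}"])
     (use assms in \<open>auto intro!: derivative_eq_intros simp: pospow_def\<close>)

lemma has_derivative_pospow':
  assumes "t > (0::real)"
  shows "((\<lambda>t. \<kappa> * t powr (\<kappa> - 1)) has_real_derivative \<kappa> * (\<kappa> - 1) * t powr (\<kappa> - 2)) (at t)"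
  using assms by (auto intro!: derivative_eq_intros)

text \<open>Bounds the derivative of \<open>t powr \<xi>\<close> in the exponent uniformly down to
  \<open>t = 0\<close>, which rests on \<open>\<kappa>0 > 0\<close>. For small \<open>t\<close>, ln
  z <= z - 1 at \<open>z = t powr (-\<kappa>0)\<close> gives \<open>1 / \<kappa>0\<close>; for large
  \<open>t\<close> both factors are at most \<open>T\<close>.\<close>

lemma powr_abs_ln_le:
  fixes t T \<xi> \<kappa>0 :: real
  assumes "0 < \<kappa>0" "\<kappa>0 \<le> \<xi>" "\<xi> \<le> 1" "0 < t" "t \<le> T"
  shows "t powr \<xi> * \<bar>ln t\<bar> \<le> T\<^sup>2 + 1 / \<kappa>0"
proof (cases "t \<le> 1")
  case True
  have "- \<kappa>0 * ln t = ln (t powr (-\<kappa>0))" using assms by (simp add: ln_powr)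
  also have "\<dots> \<le> t powr (-\<kappa>0) - 1" using assms by (intro ln_le_minus_one) auto
  finally have "- \<kappa>0 * ln t * t powr \<kappa>0 \<le> (t powr (-\<kappa>0) - 1) * t powr \<kappa>0"
    by (intro mult_right_mono) auto
  also have "\<dots> \<le> 1" using assms by (simp add: left_diff_distrib flip: powr_add)
  finally have "t powr \<kappa>0 * \<bar>ln t\<bar> \<le> 1 / \<kappa>0"
    using assms True by (simp add: field_simps)
  moreover have "t powr \<xi> * \<bar>ln t\<bar> \<le> t powr \<kappa>0 * \<bar>ln t\<bar>"
    using assms True by (intro mult_right_mono powr_mono') auto
  moreover have "T\<^sup>2 \<ge> 0" by simp
  ultimately show ?thesis by linarith
next
  case False
  have "t powr \<xi> \<le> t powr 1" using assms False by (intro powr_mono) auto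
  moreover have "ln t \<le> t" using assms ln_le_minus_one[of t] by simp
  ultimately have "t powr \<xi> * \<bar>ln t\<bar> \<le> T * T"
    using assms False by (intro mult_mono) auto
  moreover have "1 / \<kappa>0 \<ge> 0" using assms by simp
  ultimately show ?thesis unfolding power2_eq_square by linarith
qed

lemma has_derivative_powr_exponent:
  fixes t c :: real
  assumes "t > 0"
  shows "((\<lambda>\<xi>. t powr (\<xi> - c)) has_real_derivative t powr (\<xi> - c) * ln t) (at \<xi> within A)"
  using assms unfolding powr_def by (auto intro!: derivative_eq_intros)

lemma powr_exponent_lipschitz:
  fixes t T \<kappa> \<kappa>' \<kappa>0 :: real
  assumes "0 < \<kappa>0" "\<kappa> \<in> {\<kappa>0..1}" "\<kappa>' \<in> {\<kappa>0..1}" "0 < t" "t \<le> T"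
  shows "\<bar>t powr \<kappa> - t powr \<kappa>'\<bar> \<le> (T\<^sup>2 + 1 / \<kappa>0) * \<bar>\<kappa> - \<kappa>'\<bar>"
proof -
  have "norm (t powr \<kappa> - t powr \<kappa>') \<le> (T\<^sup>2 + 1 / \<kappa>0) * norm (\<kappa> - \<kappa>')"
  proof (rule field_differentiable_bound[of "{\<kappa>0..1}" _ "\<lambda>\<xi>. t powr \<xi> * ln t"])
    show "((\<lambda>\<xi>. t powr \<xi>) has_field_derivative t powr \<xi> * ln t) (at \<xi> within {\<kappa>0..1})" for \<xi>
      using has_derivative_powr_exponent[of t 0] assms by simp
  qed (use assms powr_abs_ln_le[of \<kappa>0 _ t T] in \<open>auto simp: abs_mult\<close>)
  then show ?thesis by simp
qed

text \<open>Differentiating in the exponent creates a factor \<open>ln t\<close>, unbounded at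
  infinity. It is absorbed by \<open>ln t <= t powr \<delta> / \<delta>\<close>, the origin of
  \<open>\<delta>\<close> in the decay order.\<close>

lemma powr_second_deriv_exponent_lipschitz:
  fixes t \<kappa> \<kappa>' \<kappa>1 \<delta> :: real
  assumes "\<kappa> \<in> {0..\<kappa>1}" "\<kappa>' \<in> {0..\<kappa>1}" "\<kappa>1 \<le> 1" "t \<ge> 1" "\<delta> > 0"
  shows "\<bar>\<kappa> * (\<kappa> - 1) * t powr (\<kappa> - 2) - \<kappa>' * (\<kappa>' - 1) * t powr (\<kappa>' - 2)\<bar>
     \<le> (1 + 1 / \<delta>) * t powr (\<kappa>1 + \<delta> - 2) * \<bar>\<kappa> - \<kappa>'\<bar>"
proof -
  have "norm (\<kappa> * (\<kappa> - 1) * t powr (\<kappa> - 2) - \<kappa>' * (\<kappa>' - 1) * t powr (\<kappa>' - 2))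
     \<le> (1 + 1 / \<delta>) * t powr (\<kappa>1 + \<delta> - 2) * norm (\<kappa> - \<kappa>')"
  proof (rule field_differentiable_bound[of "{0..\<kappa>1}" _
        "\<lambda>\<xi>. (2 * \<xi> - 1) * t powr (\<xi> - 2) + \<xi> * (\<xi> - 1) * (t powr (\<xi> - 2) * ln t)"])
    fix \<xi> assume \<xi>: "\<xi> \<in> {0..\<kappa>1}"
    show "((\<lambda>\<xi>. \<xi> * (\<xi> - 1) * t powr (\<xi> - 2)) has_field_derivative
       (2 * \<xi> - 1) * t powr (\<xi> - 2) + \<xi> * (\<xi> - 1) * (t powr (\<xi> - 2) * ln t)) (at \<xi> within {0..\<kappa>1})"
      using assms
      by (auto intro!: derivative_eq_intros has_derivative_powr_exponent simp: algebra_simps)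
    have ln: "ln t \<ge> 0" using assms by simp
    have a: "\<bar>2 * \<xi> - 1\<bar> \<le> 1" using \<xi> assms by (auto simp: abs_le_iff)
    have b: "\<bar>\<xi> * (\<xi> - 1)\<bar> \<le> 1"
      unfolding abs_mult using \<xi> assms by (intro mult_le_one) auto
    have "\<delta> * ln t = ln (t powr \<delta>)" using assms by (simp add: ln_powr)
    also have "\<dots> \<le> t powr \<delta> - 1" using assms by (intro ln_le_minus_one) auto
    finally have l: "ln t \<le> t powr \<delta> / \<delta>" using assms by (simp add: field_simps)
    have "norm ((2 * \<xi> - 1) * t powr (\<xi> - 2) + \<xi> * (\<xi> - 1) * (t powr (\<xi> - 2) * ln t))
      \<le> \<bar>2 * \<xi> - 1\<bar> * t powr (\<xi> - 2) + \<bar>\<xi> * (\<xi> - 1)\<bar> * (t powr (\<xi> - 2) * ln t)"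
      using ln by (auto simp: abs_mult intro!: order_trans[OF abs_triangle_ineq])
    also have "\<dots> \<le> 1 * t powr (\<xi> - 2) + 1 * (t powr (\<xi> - 2) * ln t)"
      using ln by (intro add_mono mult_right_mono a b) auto
    also have "\<dots> = t powr (\<xi> - 2) * (1 + ln t)" by (simp add: algebra_simps)
    also have "\<dots> \<le> t powr (\<kappa>1 - 2) * (t powr \<delta> + t powr \<delta> / \<delta>)"
      using \<xi> assms ln l by (intro mult_mono add_mono powr_mono ge_one_powr_ge_zero) auto
    also have "\<dots> = (1 + 1 / \<delta>) * t powr (\<kappa>1 + \<delta> - 2)"
      using assms by (simp add: algebra_simps flip: powr_add)
    finally show "norm ((2 * \<xi> - 1) * t powr (\<xi> - 2) + \<xi> * (\<xi> - 1) * (t powr (\<xi> - 2) * ln t))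
      \<le> (1 + 1 / \<delta>) * t powr (\<kappa>1 + \<delta> - 2)" .
  qed (use assms in auto)
  then show ?thesis by simp
qed

text \<open>The largest exponent \<open>b - 1/\<alpha>\<close> gives the slowest decay and dictates
  the order. Since \<open>kernel_decay_lip\<close> is linear in the kernel size \<open>K\<close>,
  the difference of two kernels is handled as one more kernel, of size proportional to
  \<open>|v - v'|\<close>.\<close>

lemma Psi_decay_lip:
  fixes \<alpha> a b \<delta> :: real
  assumes wav: "smooth_cs_wavelet \<psi>" and ab: "1/\<alpha> < a" "b - 1/\<alpha> \<le> 1" and \<delta>: "\<delta> > 0" "\<delta> < 1"
  obtains A where "A > 0"
    "\<And>v. v \<in> {a..b} \<Longrightarrow> decay_lip (2 - (b - 1/\<alpha>) - \<delta>) A (\<lambda>x. Psi \<alpha> \<psi> x v)"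
    "\<And>v v'. v \<in> {a..b} \<Longrightarrow> v' \<in> {a..b} \<Longrightarrow>
       decay_lip (2 - (b - 1/\<alpha>) - \<delta>) (A * \<bar>v - v'\<bar>) (\<lambda>x. Psi \<alpha> \<psi> x v - Psi \<alpha> \<psi> x v')"
proof -
  obtain \<psi>' R S where R: "R \<ge> 0" and S: "S > 0"
    and D: "\<And>s. (\<psi> has_real_derivative \<psi>' s) (at s)"
    and B: "\<And>s. \<bar>\<psi> s\<bar> \<le> S" and B': "\<And>s. \<bar>\<psi>' s\<bar> \<le> S"
    and Z: "\<And>s. \<bar>s\<bar> > R \<Longrightarrow> \<psi> s = 0"
    using smooth_cs_wavelet_regularity[OF wav] by metis
  note m = wavelet_vanishing_moments[OF wav]
  define q where "q = 2 - (b - 1/\<alpha>) - \<delta>"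
  have q: "q > 0" using ab \<delta> by (simp add: q_def)
  define T where "T = 3 * (R + 1) + 1"
  have T: "T \<ge> 1" "T \<le> T\<^sup>2" using R by (auto simp: T_def power2_eq_square algebra_simps)
  define c where "c = 2 * (R + 1) * (2 * (R + 1) + 2) powr q + 2 * (R + 1) ^ 3 * 2 powr q"
  have "2 * (R + 1) * (2 * (R + 1) + 2) powr q > 0" "2 * (R + 1) ^ 3 * 2 powr q > 0"
    using R by simp_all
  then have c: "c > 0" by (simp only: c_def)
  define \<kappa>0 where "\<kappa>0 = a - 1/\<alpha>"
  define \<kappa>1 where "\<kappa>1 = b - 1/\<alpha>"
  have \<kappa>0: "\<kappa>0 > 0" using ab by (simp add: \<kappa>0_def)
  \<comment> \<open>The first bracket controls the difference of two kernels on (0, T], the second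
    that of their second derivatives beyond 1. The sum also exceeds \<open>T\<close>, which bounds a
    single kernel on (0, T].\<close>
  define K where "K = (T\<^sup>2 + 1 / \<kappa>0) + (1 + 1 / \<delta>)"
  have "1 / \<kappa>0 > 0" "1 / \<delta> > 0" "T\<^sup>2 \<ge> 0" using \<kappa>0 \<delta> by auto
  then have K: "K \<ge> T\<^sup>2 + 1 / \<kappa>0" "K \<ge> 1 + 1 / \<delta>" "K \<ge> T" "K \<ge> 1" "K > 0"
    using T unfolding K_def by linarith+
  have S0: "S \<ge> 0" using S by simp
  note lip = kernel_decay_lip[OF R q _ S0 _ _ _ _ _ _ D B B' Z m, folded c_def T_def]
  have range: "v - 1/\<alpha> > 0" "v - 1/\<alpha> \<in> {\<kappa>0..1}" "v - 1/\<alpha> \<in> {0..\<kappa>1}" if "v \<in> {a..b}" for v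
    using that ab by (auto simp: \<kappa>0_def \<kappa>1_def)
  show ?thesis
  proof (rule that[of "c * K * S"], unfold q_def[symmetric])
    show "c * K * S > 0" using c K S by simp
  next
    fix v assume v: "v \<in> {a..b}"
    define \<kappa> where "\<kappa> = v - 1/\<alpha>"
    have \<kappa>: "\<kappa> > 0" "\<kappa> \<le> 1" "\<kappa> \<le> \<kappa>1" using range[OF v] by (auto simp: \<kappa>_def)
    show "decay_lip q (c * K * S) (\<lambda>x. Psi \<alpha> \<psi> x v)"
      unfolding Psi_def \<kappa>_def[symmetric]
    proof (rule lip)
      show "continuous_on UNIV (\<lambda>t. pospow t \<kappa>)" by (rule continuous_on_pospow[OF \<kappa>(1)])
      show "\<bar>pospow t \<kappa>\<bar> \<le> K" if "0 < t" "t \<le> T" for t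
      proof -
        have "t powr \<kappa> \<le> T powr \<kappa>" using that \<kappa> by (intro powr_mono2) auto
        also have "\<dots> \<le> T powr 1" using T \<kappa> by (intro powr_mono) auto
        finally show ?thesis using that T K by (simp add: pospow_def)
      qed
      show "\<bar>\<kappa> * (\<kappa> - 1) * t powr (\<kappa> - 2)\<bar> \<le> K * t powr (-q)" if "t \<ge> 1" for t
      proof -
        have "\<bar>\<kappa> * (\<kappa> - 1)\<bar> \<le> 1" unfolding abs_mult using \<kappa> by (intro mult_le_one) auto
        then have "\<bar>\<kappa> * (\<kappa> - 1) * t powr (\<kappa> - 2)\<bar> \<le> 1 * t powr (\<kappa> - 2)"
          unfolding abs_mult[of "\<kappa> * (\<kappa> - 1)"] by (intro mult_mono) auto
        also have "\<dots> \<le> K * t powr (-q)"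
          using K that \<kappa> \<delta> by (intro mult_mono powr_mono) (auto simp: q_def \<kappa>1_def)
        finally show ?thesis .
      qed
      show "((\<lambda>t. pospow t \<kappa>) has_real_derivative \<kappa> * t powr (\<kappa> - 1)) (at t)" if "t > 0" for t
        by (rule has_derivative_pospow[OF that])
      show "((\<lambda>t. \<kappa> * t powr (\<kappa> - 1)) has_real_derivative \<kappa> * (\<kappa> - 1) * t powr (\<kappa> - 2)) (at t)" if "t > 0" for t
        by (rule has_derivative_pospow'[OF that])
    qed (use K in \<open>auto simp: pospow_def\<close>)
  next
    fix v v' assume v: "v \<in> {a..b}" and v': "v' \<in> {a..b}"
    define \<kappa> where "\<kappa> = v - 1/\<alpha>"
    define \<kappa>' where "\<kappa>' = v' - 1/\<alpha>"
    have \<kappa>: "\<kappa> > 0" "\<kappa>' > 0" "\<kappa> \<in> {\<kappa>0..1}" "\<kappa> \<in> {0..\<kappa>1}" "\<kappa>' \<in> {\<kappa>0..1}" "\<kappa>' \<in> {0..\<kappa>1}"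
      using range[OF v] range[OF v'] by (auto simp: \<kappa>_def \<kappa>'_def)
    have cont: "continuous_on UNIV (\<lambda>t. pospow t \<kappa>)" "continuous_on UNIV (\<lambda>t. pospow t \<kappa>')"
      using \<kappa> by (auto intro: continuous_on_pospow)
    have cp: "continuous_on UNIV \<psi>"
      by (rule DERIV_continuous_on) (rule has_field_derivative_at_within[OF D])
    have int: "integrable lborel (\<lambda>s. pospow (x - s) k * \<psi> s)" if "continuous_on UNIV (\<lambda>t. pospow t k)" for x k
      by (rule integrable_continuous_support[of _ R])
         (intro continuous_intros continuous_on_compose2[OF that] cp, auto simp: Z)
    have eq: "Psi \<alpha> \<psi> x v - Psi \<alpha> \<psi> x v' = (LINT s|lborel. (pospow (x - s) \<kappa> - pospow (x - s) \<kappa>') * \<psi> s)" for x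
      unfolding Psi_def left_diff_distrib \<kappa>_def[symmetric] \<kappa>'_def[symmetric]
      using int cont by simp
    have "decay_lip q (c * (K * \<bar>v - v'\<bar>) * S) (\<lambda>x. Psi \<alpha> \<psi> x v - Psi \<alpha> \<psi> x v')"
      unfolding eq
    proof (rule lip)
      show "continuous_on UNIV (\<lambda>t. pospow t \<kappa> - pospow t \<kappa>')" using cont by (intro continuous_intros)
      show "\<bar>pospow t \<kappa> - pospow t \<kappa>'\<bar> \<le> K * \<bar>v - v'\<bar>" if "0 < t" "t \<le> T" for t
      proof -
        have "\<bar>pospow t \<kappa> - pospow t \<kappa>'\<bar> \<le> (T\<^sup>2 + 1 / \<kappa>0) * \<bar>\<kappa> - \<kappa>'\<bar>"
          using powr_exponent_lipschitz[OF \<kappa>0 \<kappa>(3,5) that] that by (simp add: pospow_def)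
        also have "\<dots> \<le> K * \<bar>\<kappa> - \<kappa>'\<bar>" using K by (intro mult_right_mono) auto
        finally show ?thesis by (simp add: \<kappa>_def \<kappa>'_def)
      qed
      show "\<bar>\<kappa> * (\<kappa> - 1) * t powr (\<kappa> - 2) - \<kappa>' * (\<kappa>' - 1) * t powr (\<kappa>' - 2)\<bar> \<le> K * \<bar>v - v'\<bar> * t powr (-q)"
        if "t \<ge> 1" for t
      proof -
        have "\<bar>\<kappa> * (\<kappa> - 1) * t powr (\<kappa> - 2) - \<kappa>' * (\<kappa>' - 1) * t powr (\<kappa>' - 2)\<bar>
            \<le> (1 + 1 / \<delta>) * t powr (\<kappa>1 + \<delta> - 2) * \<bar>\<kappa> - \<kappa>'\<bar>"
          using \<kappa> \<delta> that ab by (intro powr_second_deriv_exponent_lipschitz) (auto simp: \<kappa>1_def)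
        also have "\<dots> \<le> K * t powr (\<kappa>1 + \<delta> - 2) * \<bar>\<kappa> - \<kappa>'\<bar>"
          using K by (intro mult_right_mono) auto
        also have "\<kappa>1 + \<delta> - 2 = -q" by (simp add: q_def \<kappa>1_def)
        finally show ?thesis by (simp add: \<kappa>_def \<kappa>'_def mult_ac)
      qed
      show "((\<lambda>t. pospow t \<kappa> - pospow t \<kappa>') has_real_derivative \<kappa> * t powr (\<kappa> - 1) - \<kappa>' * t powr (\<kappa>' - 1)) (at t)" if "t > 0" for t
        using that by (intro DERIV_diff has_derivative_pospow)
      show "((\<lambda>t. \<kappa> * t powr (\<kappa> - 1) - \<kappa>' * t powr (\<kappa>' - 1)) has_real_derivative
         \<kappa> * (\<kappa> - 1) * t powr (\<kappa> - 2) - \<kappa>' * (\<kappa>' - 1) * t powr (\<kappa>' - 2)) (at t)" if "t > 0" for t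
        using that by (intro DERIV_diff has_derivative_pospow')
    qed (use K in \<open>auto simp: pospow_def\<close>)
    then show "decay_lip q (c * K * S * \<bar>v - v'\<bar>) (\<lambda>x. Psi \<alpha> \<psi> x v - Psi \<alpha> \<psi> x v')"
      by (simp add: mult_ac)
  qed
qed

section \<open>The wavelet series\<close>

text \<open>For \<open>j \<ge> 0\<close> the indices \<open>\<bar>k\<bar> \<le> (M + 1) 2\<^sup>j\<close> are controlled by the logarithm-free bound of \<open>\<Omega>\<^sub>1\<close>.  For all
  other indices \<open>\<bar>2\<^sup>j u - k\<bar>\<close> is comparable with \<open>\<bar>k\<bar>\<close>, so the decay of order \<open>q\<close> absorbs the growth
  in \<open>k\<close> allowed by \<open>\<Omega>\<^sub>0\<close>.\<close>

lemma coefficient_sum_bound: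
  fixes \<alpha> q \<delta> M :: real
  assumes \<alpha>: "\<alpha> > 0" and O0: "in_Omega0 \<alpha> eps" and O1: "in_Omega1 \<alpha> eps"
    and M: "M > 0" and \<delta>: "\<delta> > 0" and q: "q - (1/\<alpha> + \<delta>) > 1"
  obtains C where "C > 0"
    "\<And>j K u. finite K \<Longrightarrow> \<bar>u\<bar> \<le> M \<Longrightarrow>
       (\<Sum>k\<in>K. \<bar>eps j k\<bar> * (1 + \<bar>2 powr (real_of_int j) * u - real_of_int k\<bar>) powr (-q))
         \<le> C * (if j \<ge> 0 then 2 powr (real_of_int j / \<alpha>) else 2 powr (- \<delta> * real_of_int j))"
proof -
  define p where "p = 1/\<alpha> + \<delta>"
  have p: "p > 0" using \<alpha> \<delta> by (simp add: p_def add_pos_pos)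
  have q1: "q > 1" "q - p > 1" using q p by (auto simp: p_def)
  obtain C0 where C0: "C0 > 0"
    "\<And>j k. \<bar>eps j k\<bar> \<le> C0 * (3 + \<bar>real_of_int j\<bar>) powr p * (3 + \<bar>real_of_int k\<bar>) powr p"
    using O0 \<delta> by (auto simp: in_Omega0_def p_def)
  \<comment> \<open>Taking \<open>l = M + 1\<close> instead of \<open>M\<close> leaves a gap: an
    index outside this range is at distance at least 2^j from every \<open>2^j * u\<close> with
    \<open>|u| <= M\<close>.\<close>
  obtain C1 where C1: "C1 > 0"
    "\<And>j k. j \<ge> 0 \<Longrightarrow> \<bar>real_of_int k\<bar> * 2 powr (- real_of_int j) \<le> M + 1 \<Longrightarrow> \<bar>eps j k\<bar> \<le> C1 * 2 powr (real_of_int j / \<alpha>)"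
    using O1 M unfolding in_Omega1_def by (metis add_pos_pos zero_less_one)
  obtain S1 where S1: "S1 > 0"
    "\<And>(K :: int set) x. finite K \<Longrightarrow> (\<Sum>k\<in>K. (1 + \<bar>x - real_of_int k\<bar>) powr (-q)) \<le> S1"
    using int_shifted_powr_sum_bounded[OF q1(1)] by metis
  obtain S2 where S2: "S2 > 0"
    "\<And>K :: int set. finite K \<Longrightarrow> (\<Sum>k\<in>K. (1 + \<bar>real_of_int k\<bar>) powr (-(q - p))) \<le> S2"
    using int_powr_sum_bounded[OF q1(2)] by metis
  \<comment> \<open>The minimum makes \<open>2 powr (\<delta>' * |j|)\<close> at most
    \<open>B j\<close> for both signs of \<open>j\<close>, so the polynomial growth in
    \<open>j\<close> disappears into \<open>B j\<close>.\<close>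
  define \<delta>' where "\<delta>' = min \<delta> (1/\<alpha>)"
  have \<delta>': "\<delta>' > 0" "\<delta>' \<le> \<delta>" "\<delta>' \<le> 1/\<alpha>" using \<alpha> \<delta> by (auto simp: \<delta>'_def)
  obtain C3 where C3: "C3 > 0" "\<And>y. y \<ge> 0 \<Longrightarrow> (1 + y) powr p \<le> C3 * 2 powr (\<delta>' * y)"
    using powr_le_exponential[OF p \<delta>'(1)] by metis
  define B where "B j = (if j \<ge> 0 then 2 powr (real_of_int j / \<alpha>) else 2 powr (- \<delta> * real_of_int j))" for j :: int
  have B: "B j > 0" for j by (simp add: B_def)
  have three: "(3 + y) powr p \<le> 3 powr p * (1 + y) powr p" if "y \<ge> 0" for y :: real
  proof -
    have "(3 + y) powr p \<le> (3 * (1 + y)) powr p" using that p by (intro powr_mono2) auto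
    also have "\<dots> = 3 powr p * (1 + y) powr p" by (rule powr_mult)
    finally show ?thesis .
  qed
  have jB: "(3 + \<bar>real_of_int j\<bar>) powr p \<le> 3 powr p * C3 * B j" for j
  proof -
    have "(3 + \<bar>real_of_int j\<bar>) powr p \<le> 3 powr p * (1 + \<bar>real_of_int j\<bar>) powr p" by (rule three) simp
    also have "\<dots> \<le> 3 powr p * (C3 * 2 powr (\<delta>' * \<bar>real_of_int j\<bar>))"
      by (intro mult_left_mono C3) auto
    also have "\<dots> \<le> 3 powr p * (C3 * B j)"
    proof (intro mult_left_mono)
      show "2 powr (\<delta>' * \<bar>real_of_int j\<bar>) \<le> B j"
        using \<delta>' mult_right_mono[of \<delta>' "1/\<alpha>" "real_of_int j"] mult_right_mono[of \<delta>' "\<delta>" "- real_of_int j"]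
        by (auto simp: B_def intro!: powr_mono)
    qed (use C3 in auto)
    finally show ?thesis by simp
  qed
  define D where "D = C0 * (3 powr p * C3) * 3 powr p * (M + 1) powr q"
  have D: "D > 0" using C0 C3 M by (simp add: D_def)
  have far: "\<bar>eps j k\<bar> * (1 + \<bar>x - real_of_int k\<bar>) powr (-q) \<le> D * B j * (1 + \<bar>real_of_int k\<bar>) powr (-(q - p))"
    if "1 + \<bar>real_of_int k\<bar> \<le> (M + 1) * (1 + \<bar>x - real_of_int k\<bar>)" for j k x
  proof -
    have "(1 + \<bar>x - real_of_int k\<bar>) powr (-q) \<le> ((1 + \<bar>real_of_int k\<bar>) / (M + 1)) powr (-q)"
      using that M q1 by (intro powr_mono2') (auto simp: field_simps)
    also have "\<dots> = (M + 1) powr q * (1 + \<bar>real_of_int k\<bar>) powr (-q)"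
      using M by (subst powr_divide) (auto simp: powr_minus_divide)
    finally have 1: "(1 + \<bar>x - real_of_int k\<bar>) powr (-q) \<le> (M + 1) powr q * (1 + \<bar>real_of_int k\<bar>) powr (-q)" .
    have "\<bar>eps j k\<bar> \<le> C0 * (3 + \<bar>real_of_int j\<bar>) powr p * (3 + \<bar>real_of_int k\<bar>) powr p" by (rule C0)
    also have "\<dots> \<le> C0 * (3 powr p * C3 * B j) * (3 powr p * (1 + \<bar>real_of_int k\<bar>) powr p)"
      using C0 C3 B[of j] by (intro mult_mono jB three) (auto intro!: mult_nonneg_nonneg)
    finally have 2: "\<bar>eps j k\<bar> \<le> C0 * (3 powr p * C3 * B j) * (3 powr p * (1 + \<bar>real_of_int k\<bar>) powr p)" .
    have "\<bar>eps j k\<bar> * (1 + \<bar>x - real_of_int k\<bar>) powr (-q) \<le>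
       C0 * (3 powr p * C3 * B j) * (3 powr p * (1 + \<bar>real_of_int k\<bar>) powr p) * ((M + 1) powr q * (1 + \<bar>real_of_int k\<bar>) powr (-q))"
      using C0 C3 B[of j] by (intro mult_mono 1 2) (auto intro!: mult_nonneg_nonneg)
    also have "\<dots> = D * B j * ((1 + \<bar>real_of_int k\<bar>) powr p * (1 + \<bar>real_of_int k\<bar>) powr (-q))"
      by (simp add: D_def)
    also have "(1 + \<bar>real_of_int k\<bar>) powr p * (1 + \<bar>real_of_int k\<bar>) powr (-q) = (1 + \<bar>real_of_int k\<bar>) powr (-(q - p))"
      by (simp flip: powr_add)
    finally show ?thesis .
  qed
  \<comment> \<open>Bounding every term by the sum of the near and far contributions avoids
    splitting the index set: each weight is summed over all of \<open>K\<close>.\<close>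
  have main: "\<bar>eps j k\<bar> * (1 + \<bar>2 powr (real_of_int j) * u - real_of_int k\<bar>) powr (-q)
     \<le> B j * (C1 * (1 + \<bar>2 powr (real_of_int j) * u - real_of_int k\<bar>) powr (-q) + D * (1 + \<bar>real_of_int k\<bar>) powr (-(q - p)))"
    if u: "\<bar>u\<bar> \<le> M" for j k u
  proof -
    define x where "x = 2 powr (real_of_int j) * u"
    have x: "\<bar>x\<bar> \<le> 2 powr (real_of_int j) * M" using u by (simp add: x_def abs_mult)
    show ?thesis
    proof (cases "j \<ge> 0 \<and> \<bar>real_of_int k\<bar> * 2 powr (- real_of_int j) \<le> M + 1")
      case True
      then have "\<bar>eps j k\<bar> \<le> B j * C1" using C1(2)[of j k] by (simp add: B_def mult.commute)
      then have "\<bar>eps j k\<bar> * (1 + \<bar>x - real_of_int k\<bar>) powr (-q) \<le> B j * C1 * (1 + \<bar>x - real_of_int k\<bar>) powr (-q)"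
        by (intro mult_right_mono) auto
      moreover have "B j * (D * (1 + \<bar>real_of_int k\<bar>) powr (-(q - p))) \<ge> 0" using B[of j] D by simp
      ultimately show ?thesis unfolding x_def[symmetric] distrib_left by simp
    next
      case False
      \<comment> \<open>For \<open>j >= 0\<close>, \<open>|x| <= 2^j * M\<close> is at most the
        fraction M/(M+1) of \<open>|k|\<close>. For \<open>j < 0\<close>, \<open>|x| <= M\<close>,
        whatever \<open>k\<close> is.\<close>
      have "1 + \<bar>real_of_int k\<bar> \<le> (M + 1) * (1 + \<bar>x - real_of_int k\<bar>)"
      proof (cases "j \<ge> 0")
        case True
        with False have "\<bar>real_of_int k\<bar> \<ge> (M + 1) * 2 powr (real_of_int j)"
          by (simp add: powr_minus field_simps)
        then have "M * ((M + 1) * 2 powr (real_of_int j)) \<le> M * \<bar>real_of_int k\<bar>"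
          using M by (intro mult_left_mono) auto
        moreover have "(M + 1) * \<bar>x\<bar> \<le> (M + 1) * (2 powr (real_of_int j) * M)"
          using M x by (intro mult_left_mono) auto
        moreover have "(M + 1) * \<bar>real_of_int k\<bar> \<le> (M + 1) * (\<bar>x\<bar> + \<bar>x - real_of_int k\<bar>)"
          using M by (intro mult_left_mono) auto
        ultimately show ?thesis using M by (simp add: algebra_simps)
      next
        case neg: False
        then have "2 powr (real_of_int j) \<le> 2 powr 0" by (intro powr_mono) auto
        then have "2 powr (real_of_int j) * M \<le> 1 * M" using M by (intro mult_right_mono) auto
        moreover have "M * \<bar>x - real_of_int k\<bar> \<ge> 0" using M by simp
        moreover have "(M + 1) * (1 + \<bar>x - real_of_int k\<bar>) = 1 + M + \<bar>x - real_of_int k\<bar> + M * \<bar>x - real_of_int k\<bar>"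
          by (simp add: algebra_simps)
        ultimately show ?thesis using x by linarith
      qed
      from far[OF this, of j]
      have "\<bar>eps j k\<bar> * (1 + \<bar>x - real_of_int k\<bar>) powr (-q) \<le> B j * (D * (1 + \<bar>real_of_int k\<bar>) powr (-(q - p)))"
        by (simp add: mult_ac)
      moreover have "B j * (C1 * (1 + \<bar>x - real_of_int k\<bar>) powr (-q)) \<ge> 0" using B[of j] C1 by simp
      ultimately show ?thesis unfolding x_def[symmetric] distrib_left by simp
    qed
  qed
  show ?thesis
  proof (rule that[of "C1 * S1 + D * S2"])
    show "C1 * S1 + D * S2 > 0" using C1 S1 D S2 by (simp add: add_pos_pos)
  next
    fix j u and K :: "int set" assume K: "finite K" and u: "\<bar>u\<bar> \<le> M"
    have "(\<Sum>k\<in>K. \<bar>eps j k\<bar> * (1 + \<bar>2 powr (real_of_int j) * u - real_of_int k\<bar>) powr (-q))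
      \<le> B j * (C1 * (\<Sum>k\<in>K. (1 + \<bar>2 powr (real_of_int j) * u - real_of_int k\<bar>) powr (-q)) +
               D * (\<Sum>k\<in>K. (1 + \<bar>real_of_int k\<bar>) powr (-(q - p))))"
      unfolding sum_distrib_left sum.distrib[symmetric] by (intro sum_mono main[OF u])
    also have "\<dots> \<le> B j * (C1 * S1 + D * S2)"
      using B[of j] C1 D S1(2)[OF K] S2(2)[OF K] by (intro mult_left_mono add_mono) auto
    finally show "(\<Sum>k\<in>K. \<bar>eps j k\<bar> * (1 + \<bar>2 powr (real_of_int j) * u - real_of_int k\<bar>) powr (-q))
      \<le> (C1 * S1 + D * S2) * (if j \<ge> 0 then 2 powr (real_of_int j / \<alpha>) else 2 powr (- \<delta> * real_of_int j))"
      by (simp add: B_def mult.commute)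
  qed
qed

section \<open>Absolute summation over translations and levels\<close>

lemma infsum_diff:
  fixes f g :: "'a \<Rightarrow> real"
  assumes "f summable_on A" "g summable_on A"
  shows "infsum (\<lambda>x. f x - g x) A = infsum f A - infsum g A"
  using infsum_add[OF assms(1), of "\<lambda>x. - g x"] assms(2)
  by (simp add: summable_on_uminus infsum_uminus)

text \<open>A finite set of pairs lies in a finite rectangle, so iterated finite bounds control the
  unordered sum. Summability must be delivered as well, since \<open>infsum\<close> is 0 by default
  and would not be additive otherwise.\<close>

lemma double_series_bound:
  fixes g :: "int \<Rightarrow> int \<Rightarrow> real"
  assumes inner: "\<And>j K. finite K \<Longrightarrow> (\<Sum>k\<in>K. \<bar>g j k\<bar>) \<le> H j"
    and outer: "\<And>J. finite J \<Longrightarrow> (\<Sum>j\<in>J. H j) \<le> S"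
  shows "(\<lambda>(j, k). g j k) summable_on UNIV" "\<bar>\<Sum>\<^sub>\<infinity>(j, k)\<in>UNIV. g j k\<bar> \<le> S"
proof -
  have fin: "(\<Sum>z\<in>F. norm (case z of (j, k) \<Rightarrow> g j k)) \<le> S" if F: "finite F" for F
  proof -
    have "(\<Sum>z\<in>F. norm (case z of (j, k) \<Rightarrow> g j k)) \<le> (\<Sum>z\<in>fst ` F \<times> snd ` F. norm (case z of (j, k) \<Rightarrow> g j k))"
      using F by (intro sum_mono2) force+
    also have "\<dots> = (\<Sum>j\<in>fst ` F. \<Sum>k\<in>snd ` F. \<bar>g j k\<bar>)"
      by (subst sum.cartesian_product) (auto simp: case_prod_unfold)
    also have "\<dots> \<le> (\<Sum>j\<in>fst ` F. H j)" using F by (intro sum_mono inner) auto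
    also have "\<dots> \<le> S" using F by (intro outer) auto
    finally show ?thesis .
  qed
  have abs: "(\<lambda>z. norm (case z of (j, k) \<Rightarrow> g j k)) summable_on UNIV"
    by (rule nonneg_bdd_above_summable_on) (use fin in \<open>auto intro!: bdd_aboveI2[of _ _ S]\<close>)
  then show "(\<lambda>(j, k). g j k) summable_on UNIV" by (rule abs_summable_summable)
  have "norm (\<Sum>\<^sub>\<infinity>(j, k)\<in>UNIV. g j k) \<le> (\<Sum>\<^sub>\<infinity>z\<in>UNIV. norm (case z of (j, k) \<Rightarrow> g j k))"
    by (rule norm_infsum_bound[OF abs])
  also have "\<dots> \<le> S" by (rule infsum_le_finite_sums[OF abs]) (rule fin)
  finally show "\<bar>\<Sum>\<^sub>\<infinity>(j, k)\<in>UNIV. g j k\<bar> \<le> S" by simp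
qed

text \<open>The minimum is the better of two estimates: the Lipschitz clause gives
  \<open>s * |u - u'|\<close>, while bounding the two values separately by decay gives 1. The factor
  2 comes from the weights at \<open>u\<close> and \<open>u'\<close>, each summed by
  \<open>E\<close>.\<close>

lemma decay_lip_increment_sum:
  fixes P :: "real \<Rightarrow> real"
  assumes P: "decay_lip q A P" and A: "A \<ge> 0"
    and E: "\<And>u. \<bar>u\<bar> \<le> M \<Longrightarrow>
       (\<Sum>k\<in>K. \<bar>e k\<bar> * (1 + \<bar>s * u - real_of_int k\<bar>) powr (-q)) \<le> B"
    and u: "\<bar>u\<bar> \<le> M" "\<bar>u'\<bar> \<le> M" and s: "s > 0"
  shows "(\<Sum>k\<in>K. \<bar>e k * (P (s * u - real_of_int k) - P (s * u' - real_of_int k))\<bar>)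
     \<le> 2 * A * (B * min 1 (s * \<bar>u - u'\<bar>))"
proof -
  define m where "m = min 1 (s * \<bar>u - u'\<bar>)"
  define w where "w u k = (1 + \<bar>s * u - real_of_int k\<bar>) powr (-q)" for u k
  have m: "m \<ge> 0" using s by (simp add: m_def)
  have t: "\<bar>e k * (P (s * u - real_of_int k) - P (s * u' - real_of_int k))\<bar> \<le> A * m * (\<bar>e k\<bar> * w u k + \<bar>e k\<bar> * w u' k)" for k
  proof -
    define x y where "x = s * u - real_of_int k" and "y = s * u' - real_of_int k"
    have "\<bar>x - y\<bar> = s * \<bar>u - u'\<bar>"
      using s by (simp add: x_def y_def abs_mult flip: right_diff_distrib)
    moreover have "\<bar>P x - P y\<bar> \<le> A * \<bar>x - y\<bar> * (w u k + w u' k)" "\<bar>P x\<bar> \<le> A * w u k" "\<bar>P y\<bar> \<le> A * w u' k"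
      using P unfolding decay_lip_def w_def x_def[symmetric] y_def[symmetric] by blast+
    then have "\<bar>P x - P y\<bar> \<le> A * \<bar>x - y\<bar> * (w u k + w u' k)" "\<bar>P x - P y\<bar> \<le> A * 1 * (w u k + w u' k)"
      by (auto simp: algebra_simps)
    ultimately have "\<bar>P x - P y\<bar> \<le> A * m * (w u k + w u' k)"
      by (auto simp: m_def min_def)
    then have "\<bar>e k\<bar> * \<bar>P x - P y\<bar> \<le> \<bar>e k\<bar> * (A * m * (w u k + w u' k))"
      by (intro mult_left_mono) auto
    then show ?thesis
      unfolding abs_mult x_def[symmetric] y_def[symmetric] by (simp add: algebra_simps)
  qed
  have "(\<Sum>k\<in>K. \<bar>e k * (P (s * u - real_of_int k) - P (s * u' - real_of_int k))\<bar>)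
      \<le> A * m * ((\<Sum>k\<in>K. \<bar>e k\<bar> * w u k) + (\<Sum>k\<in>K. \<bar>e k\<bar> * w u' k))"
    unfolding sum.distrib[symmetric] sum_distrib_left by (intro sum_mono t)
  also have "\<dots> \<le> A * m * (B + B)"
    using A m E[OF u(1)] E[OF u(2)] by (intro mult_left_mono add_mono) (auto simp: w_def)
  finally show ?thesis by (simp add: m_def algebra_simps)
qed

text \<open>The sum over \<open>j \<ge> 0\<close> is split where \<open>2\<^sup>j h = 1\<close>; both parts are geometric and dominated by their terms at
  the cut, of size \<open>h\<close> to the power \<open>v - 1/\<alpha>\<close>.\<close>

lemma frequency_sum_holder:
  fixes \<alpha> a b \<delta> M :: real
  assumes a: "1/\<alpha> < a" and \<alpha>: "\<alpha> > 0" and b: "b + \<delta> < 1" and \<delta>: "\<delta> > 0" and M: "M > 0"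
  obtains C where "C > 0"
    "\<And>J v h. finite J \<Longrightarrow> v \<in> {a..b} \<Longrightarrow> 0 \<le> h \<Longrightarrow> h \<le> 2 * M \<Longrightarrow>
       (\<Sum>j\<in>J. 2 powr (- real_of_int j * v) *
          ((if j \<ge> 0 then 2 powr (real_of_int j / \<alpha>) else 2 powr (- \<delta> * real_of_int j)) *
           min 1 (2 powr (real_of_int j) * h))) \<le> C * h powr (v - 1/\<alpha>)"
proof -
  \<comment> \<open>The geometric constant decreases in \<open>\<theta>\<close>, so its values at
    \<open>\<rho>\<close> and \<open>\<kappa>0\<close> serve all \<open>v\<close> in
    \<open>{a..b}\<close> at once.\<close>
  define G where "G \<theta> = 1 / (1 - 2 powr (-\<theta>))" for \<theta> :: real
  have G: "G \<theta> > 0" if "\<theta> > 0" for \<theta> using that by (simp add: G_def powr_less_one)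
  have Gmono: "G \<theta>' \<le> G \<theta>" if "0 < \<theta>" "\<theta> \<le> \<theta>'" for \<theta> \<theta>'
    using that by (auto simp: G_def powr_less_one intro!: divide_left_mono mult_pos_pos)
  define \<kappa>0 where "\<kappa>0 = a - 1/\<alpha>"
  define \<rho> where "\<rho> = 1 - b - \<delta>"
  have pos: "\<kappa>0 > 0" "\<rho> > 0" using a b by (auto simp: \<kappa>0_def \<rho>_def)
  have inv: "1/\<alpha> > 0" using \<alpha> by simp
  show ?thesis
  proof (rule that[of "(1 + 2 * M) * G \<rho> + G \<rho> + G \<kappa>0"])
    show "(1 + 2 * M) * G \<rho> + G \<rho> + G \<kappa>0 > 0"
      using G[OF pos(1)] G[OF pos(2)] M by (intro add_pos_pos mult_pos_pos) auto
  next
    fix J :: "int set" and v h :: real assume J: "finite J" and v: "v \<in> {a..b}" and h: "0 \<le> h" "h \<le> 2 * M"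
    define \<kappa> where "\<kappa> = v - 1/\<alpha>"
    have "a \<le> v" "v \<le> b" using v by auto
    then have \<kappa>: "\<kappa> \<ge> \<kappa>0" "\<kappa> > 0" "1 - \<kappa> \<ge> \<rho>" "1 - \<kappa> > 0" "1 - \<kappa> \<le> 1"
      using a b \<delta> inv unfolding \<kappa>_def \<kappa>0_def \<rho>_def by linarith+
    define T where "T j = 2 powr (- real_of_int j * v) *
          ((if j \<ge> 0 then 2 powr (real_of_int j / \<alpha>) else 2 powr (- \<delta> * real_of_int j)) *
           min 1 (2 powr (real_of_int j) * h))" for j
    show "sum T J \<le> ((1 + 2 * M) * G \<rho> + G \<rho> + G \<kappa>0) * h powr (v - 1/\<alpha>)"
    proof (cases "h = 0")
      case True
      then show ?thesis by (simp add: T_def)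
    next
      case False
      then have h0: "h > 0" using h by simp
      define t where "t = - log 2 h"
      have t: "2 powr (t * c) = h powr (- c)" for c
        using h0 by (simp add: t_def powr_powr[symmetric] powr_minus powr_def log_def)
      define J1 J2 J3 where "J1 = {j\<in>J. j < 0}" and "J2 = {j\<in>J. j \<ge> 0 \<and> real_of_int j \<le> t}"
        and "J3 = {j\<in>J. j \<ge> 0 \<and> real_of_int j > t}"
      have "J = J1 \<union> J2 \<union> J3" by (auto simp: J1_def J2_def J3_def)
      then have "sum T J = sum T J1 + sum T J2 + sum T J3"
        using J by (subst sum.union_disjoint[symmetric] | force simp: J1_def J2_def J3_def)+
      \<comment> \<open>At negative levels the linear branch of the minimum gives order
        \<open>h\<close>; convergence as \<open>j\<close> tends to minus infinity uses
        \<open>\<rho> > 0\<close>.\<close>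
      moreover have "sum T J1 \<le> (1 + 2 * M) * G \<rho> * h powr \<kappa>"
      proof -
        have "T j \<le> h * 2 powr (real_of_int j * \<rho>)" if "j \<in> J1" for j
        proof -
          have j: "j < 0" using that by (simp add: J1_def)
          have "T j \<le> 2 powr (- real_of_int j * b) * (2 powr (- \<delta> * real_of_int j) * (2 powr (real_of_int j) * h))"
            using j v h0 by (auto simp: T_def intro!: mult_mono powr_mono)
          also have "\<dots> = h * 2 powr (- real_of_int j * b + (- \<delta> * real_of_int j + real_of_int j))"
            by (simp only: powr_add mult_ac)
          also have "- real_of_int j * b + (- \<delta> * real_of_int j + real_of_int j) = real_of_int j * \<rho>"
            by (simp add: \<rho>_def algebra_simps)
          finally show ?thesis .
        qed
        then have "sum T J1 \<le> h * (\<Sum>j\<in>J1. 2 powr (real_of_int j * \<rho>))"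
          unfolding sum_distrib_left by (intro sum_mono)
        also have "\<dots> \<le> h * (2 powr (0 * \<rho>) / (1 - 2 powr (-\<rho>)))"
          using J h0 pos by (intro mult_left_mono geometric_sum_upto) (auto simp: J1_def)
        also have "\<dots> = G \<rho> * h" using h0 by (simp add: G_def)
        \<comment> \<open>Since \<open>h\<close> may be below or above 1,
          \<open>h powr (1 - \<kappa>)\<close> is compared with the base \<open>1 + 2 * M\<close>,
          for which the exponent can be raised to 1.\<close>
        also have "h \<le> (1 + 2 * M) * h powr \<kappa>"
        proof -
          have "h = h powr (1 - \<kappa>) * h powr \<kappa>" using h0 by (simp flip: powr_add)
          moreover have "h powr (1 - \<kappa>) \<le> (1 + 2 * M) powr (1 - \<kappa>)"
            using h h0 \<kappa> by (intro powr_mono2) auto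
          moreover have "(1 + 2 * M) powr (1 - \<kappa>) \<le> (1 + 2 * M) powr 1"
            using M \<kappa> by (intro powr_mono) auto
          moreover have "(1 + 2 * M) powr 1 = 1 + 2 * M" using M by simp
          ultimately show ?thesis by (metis mult_right_mono order_trans powr_ge_zero)
        qed
        finally show ?thesis using G[OF pos(2)] by (simp add: mult_ac)
      qed
      moreover have "sum T J2 \<le> G \<rho> * h powr \<kappa>"
      proof -
        have "T j \<le> h * 2 powr (real_of_int j * (1 - \<kappa>))" if "j \<in> J2" for j
        proof -
          have j: "j \<ge> 0" using that by (simp add: J2_def)
          have "T j \<le> 2 powr (- real_of_int j * v) * (2 powr (real_of_int j / \<alpha>) * (2 powr (real_of_int j) * h))"
            using j h0 by (auto simp: T_def intro!: mult_left_mono)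
          also have "\<dots> = h * 2 powr (- real_of_int j * v + (real_of_int j / \<alpha> + real_of_int j))"
            by (simp only: powr_add mult_ac)
          also have "- real_of_int j * v + (real_of_int j / \<alpha> + real_of_int j) = real_of_int j * (1 - \<kappa>)"
            by (simp add: \<kappa>_def algebra_simps)
          finally show ?thesis .
        qed
        then have "sum T J2 \<le> h * (\<Sum>j\<in>J2. 2 powr (real_of_int j * (1 - \<kappa>)))"
          unfolding sum_distrib_left by (intro sum_mono)
        also have "\<dots> \<le> h * (2 powr (t * (1 - \<kappa>)) / (1 - 2 powr (-(1 - \<kappa>))))"
          using J h0 \<kappa> by (intro mult_left_mono geometric_sum_upto) (auto simp: J2_def)
        also have "\<dots> = G (1 - \<kappa>) * (h powr 1 * h powr (- (1 - \<kappa>)))"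
          unfolding t G_def using h0 by simp
        also have "h powr 1 * h powr (- (1 - \<kappa>)) = h powr \<kappa>"
          by (simp only: powr_add[symmetric]) simp
        also have "G (1 - \<kappa>) * h powr \<kappa> \<le> G \<rho> * h powr \<kappa>"
          using \<kappa> pos by (intro mult_right_mono Gmono) auto
        finally show ?thesis .
      qed
      moreover have "sum T J3 \<le> G \<kappa>0 * h powr \<kappa>"
      proof -
        have "T j \<le> 2 powr (- real_of_int j * \<kappa>)" if "j \<in> J3" for j
        proof -
          have j: "j \<ge> 0" using that by (simp add: J3_def)
          have "T j \<le> 2 powr (- real_of_int j * v) * (2 powr (real_of_int j / \<alpha>) * 1)"
            using j h0 by (auto simp: T_def intro!: mult_left_mono)
          also have "\<dots> = 2 powr (- real_of_int j * v + real_of_int j / \<alpha>)"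
            by (simp only: powr_add mult_ac)
          also have "- real_of_int j * v + real_of_int j / \<alpha> = - real_of_int j * \<kappa>"
            by (simp add: \<kappa>_def algebra_simps)
          finally show ?thesis .
        qed
        then have "sum T J3 \<le> (\<Sum>j\<in>J3. 2 powr (- real_of_int j * \<kappa>))"
          by (intro sum_mono)
        also have "\<dots> \<le> 2 powr (- t * \<kappa>) / (1 - 2 powr (-\<kappa>))"
          using J \<kappa> by (intro geometric_sum_from) (auto simp: J3_def)
        also have "\<dots> = G \<kappa> * h powr \<kappa>"
          using t[of "-\<kappa>"] by (simp add: G_def)
        also have "\<dots> \<le> G \<kappa>0 * h powr \<kappa>"
          using \<kappa> pos by (intro mult_right_mono Gmono) auto
        finally show ?thesis .
      qed
      ultimately show ?thesis unfolding \<kappa>_def[symmetric] distrib_right by linarith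
    qed
  qed
qed

text \<open>Serves the increments in \<open>v\<close>: the factor \<open>1 + |j|\<close> stems from
  differentiating \<open>2 powr (- j * v)\<close>. The minimum matters at negative levels, where its
  factor 2^j restores convergence.\<close>

lemma frequency_sum_bounded:
  fixes \<alpha> a b \<delta> M :: real
  assumes a: "1/\<alpha> < a" "a \<le> b" and b: "b + \<delta> < 1" and M: "M > 0"
  obtains C where "C > 0"
    "\<And>J h. finite J \<Longrightarrow> 0 \<le> h \<Longrightarrow> h \<le> 2 * M \<Longrightarrow>
       (\<Sum>j\<in>J. (1 + \<bar>real_of_int j\<bar>) * (2 powr (- real_of_int j * a) + 2 powr (- real_of_int j * b)) *
          ((if j \<ge> 0 then 2 powr (real_of_int j / \<alpha>) else 2 powr (- \<delta> * real_of_int j)) *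
           min 1 (2 powr (real_of_int j) * h))) \<le> C"
proof -
  define \<rho> where "\<rho> = min (a - 1/\<alpha>) (1 - b - \<delta>)"
  have \<rho>: "\<rho> > 0" "\<rho> \<le> a - 1/\<alpha>" "\<rho> \<le> 1 - b - \<delta>" using a b by (auto simp: \<rho>_def)
  \<comment> \<open>Exponent 3: one power for the factor \<open>1 + |j|\<close>, two to leave a
    summable \<open>(1 + |j|) powr (-2)\<close>.\<close>
  obtain D where D: "D > 0" "\<And>y. y \<ge> 0 \<Longrightarrow> (1 + y) powr 3 \<le> D * 2 powr (\<rho> * y)"
    using powr_le_exponential[of 3 \<rho>] \<rho> by auto
  obtain S where S: "S > 0" "\<And>K :: int set. finite K \<Longrightarrow> (\<Sum>k\<in>K. (1 + \<bar>real_of_int k\<bar>) powr (-2)) \<le> S"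
    using int_powr_sum_bounded[of 2] by auto
  show ?thesis
  proof (rule that[of "2 * (1 + 2 * M) * D * S"])
    show "2 * (1 + 2 * M) * D * S > 0" using M D S by simp
  next
    fix J :: "int set" and h :: real assume J: "finite J" and h: "0 \<le> h" "h \<le> 2 * M"
    define T where "T j = (2 powr (- real_of_int j * a) + 2 powr (- real_of_int j * b)) *
          ((if j \<ge> 0 then 2 powr (real_of_int j / \<alpha>) else 2 powr (- \<delta> * real_of_int j)) *
           min 1 (2 powr (real_of_int j) * h))" for j
    have T: "T j \<le> 2 * (1 + 2 * M) * 2 powr (- \<rho> * \<bar>real_of_int j\<bar>)" for j
    proof (cases "j \<ge> 0")
      case True
      have "2 powr (- real_of_int j * b) \<le> 2 powr (- real_of_int j * a)"
        using True a by (intro powr_mono) (auto intro!: mult_left_mono)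
      then have "T j \<le> (2 * 2 powr (- real_of_int j * a)) * (2 powr (real_of_int j / \<alpha>) * (1 + 2 * M))"
        unfolding T_def using True h M by (intro mult_mono) auto
      also have "\<dots> = 2 * (1 + 2 * M) * 2 powr (- real_of_int j * a + real_of_int j / \<alpha>)"
        by (simp only: powr_add mult_ac)
      also have "\<dots> \<le> 2 * (1 + 2 * M) * 2 powr (- \<rho> * \<bar>real_of_int j\<bar>)"
        using True M mult_left_mono[OF \<rho>(2), of "real_of_int j"]
        by (intro mult_left_mono powr_mono) (auto simp: algebra_simps)
      finally show ?thesis .
    next
      case False
      then have "2 powr (- real_of_int j * a) \<le> 2 powr (- real_of_int j * b)"
        using a by (intro powr_mono) (auto intro!: mult_left_mono)
      moreover have "min 1 (2 powr (real_of_int j) * h) \<le> 2 powr (real_of_int j) * (1 + 2 * M)"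
        using h by (auto intro!: min.coboundedI2 mult_left_mono)
      ultimately have "T j \<le> (2 * 2 powr (- real_of_int j * b)) * (2 powr (- \<delta> * real_of_int j) * (2 powr (real_of_int j) * (1 + 2 * M)))"
        unfolding T_def using False h M by (intro mult_mono) auto
      also have "\<dots> = 2 * (1 + 2 * M) * 2 powr (- real_of_int j * b + (- \<delta> * real_of_int j + real_of_int j))"
        by (simp only: powr_add mult_ac)
      also have "\<dots> \<le> 2 * (1 + 2 * M) * 2 powr (- \<rho> * \<bar>real_of_int j\<bar>)"
        using False M mult_left_mono[OF \<rho>(3), of "- real_of_int j"]
        by (intro mult_left_mono powr_mono) (auto simp: algebra_simps)
      finally show ?thesis .
    qed
    have e: "(1 + y) * 2 powr (- \<rho> * y) \<le> D * (1 + y) powr (-2)" if "y \<ge> 0" for y :: real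
    proof -
      have "(1 + y) * 2 powr (- \<rho> * y) = (1 + y) powr (-2) * (1 + y) powr 3 * 2 powr (- \<rho> * y)"
        using that by (simp only: powr_add[symmetric]) simp
      also have "\<dots> \<le> (1 + y) powr (-2) * (D * 2 powr (\<rho> * y)) * 2 powr (- \<rho> * y)"
        by (intro mult_left_mono mult_right_mono D that) auto
      also have "\<dots> = D * (1 + y) powr (-2)" by (simp add: powr_minus)
      finally show ?thesis .
    qed
    have "(1 + \<bar>real_of_int j\<bar>) * T j \<le> 2 * (1 + 2 * M) * D * (1 + \<bar>real_of_int j\<bar>) powr (-2)" for j
    proof -
      have "(1 + \<bar>real_of_int j\<bar>) * T j \<le> (1 + \<bar>real_of_int j\<bar>) * (2 * (1 + 2 * M) * 2 powr (- \<rho> * \<bar>real_of_int j\<bar>))"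
        by (intro mult_left_mono T) auto
      also have "\<dots> = 2 * (1 + 2 * M) * ((1 + \<bar>real_of_int j\<bar>) * 2 powr (- \<rho> * \<bar>real_of_int j\<bar>))"
        by simp
      also have "\<dots> \<le> 2 * (1 + 2 * M) * (D * (1 + \<bar>real_of_int j\<bar>) powr (-2))"
        using M by (intro mult_left_mono e) auto
      finally show ?thesis by simp
    qed
    then have "(\<Sum>j\<in>J. (1 + \<bar>real_of_int j\<bar>) * T j) \<le> 2 * (1 + 2 * M) * D * (\<Sum>j\<in>J. (1 + \<bar>real_of_int j\<bar>) powr (-2))"
      unfolding sum_distrib_left by (intro sum_mono)
    also have "\<dots> \<le> 2 * (1 + 2 * M) * D * S"
      using M D S(2)[OF J] by (intro mult_left_mono) auto
    finally show "(\<Sum>j\<in>J. (1 + \<bar>real_of_int j\<bar>) * (2 powr (- real_of_int j * a) + 2 powr (- real_of_int j * b)) *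
          ((if j \<ge> 0 then 2 powr (real_of_int j / \<alpha>) else 2 powr (- \<delta> * real_of_int j)) *
           min 1 (2 powr (real_of_int j) * h))) \<le> 2 * (1 + 2 * M) * D * S"
      by (simp only: T_def mult.assoc)
  qed
qed

text \<open>The maximum sits at \<open>a\<close> for \<open>j >= 0\<close> and at \<open>b\<close>
  for \<open>j < 0\<close>; adding both gives one bound independent of the sign of
  \<open>j\<close>.\<close>

lemma dyadic_powr_le_endpoints:
  fixes a b v :: real and j :: int
  assumes "v \<in> {a..b}"
  shows "2 powr (- real_of_int j * v) \<le> 2 powr (- real_of_int j * a) + 2 powr (- real_of_int j * b)"
proof (cases "j \<ge> 0")
  case True
  then have "2 powr (- real_of_int j * v) \<le> 2 powr (- real_of_int j * a)"
    using assms by (intro powr_mono) (auto intro!: mult_left_mono)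
  then show ?thesis by (smt (verit) powr_ge_zero)
next
  case False
  then have "2 powr (- real_of_int j * v) \<le> 2 powr (- real_of_int j * b)"
    using assms by (intro powr_mono) (auto intro!: mult_left_mono)
  then show ?thesis by (smt (verit) powr_ge_zero)
qed

lemma dyadic_powr_lipschitz:
  fixes a b v v' :: real and j :: int
  assumes "v \<in> {a..b}" "v' \<in> {a..b}"
  shows "\<bar>2 powr (- real_of_int j * v) - 2 powr (- real_of_int j * v')\<bar>
     \<le> \<bar>v - v'\<bar> * (\<bar>real_of_int j\<bar> * (2 powr (- real_of_int j * a) + 2 powr (- real_of_int j * b)))"
proof -
  have "norm (2 powr (- real_of_int j * v) - 2 powr (- real_of_int j * v'))
     \<le> (\<bar>real_of_int j\<bar> * (2 powr (- real_of_int j * a) + 2 powr (- real_of_int j * b))) * norm (v - v')"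
  proof (rule field_differentiable_bound[of "{a..b}" _ "\<lambda>\<xi>. - real_of_int j * ln 2 * 2 powr (- real_of_int j * \<xi>)"])
    fix \<xi> assume \<xi>: "\<xi> \<in> {a..b}"
    show "((\<lambda>\<xi>. 2 powr (- real_of_int j * \<xi>)) has_field_derivative - real_of_int j * ln 2 * 2 powr (- real_of_int j * \<xi>)) (at \<xi> within {a..b})"
      unfolding powr_def by (auto intro!: derivative_eq_intros)
    have "norm (- real_of_int j * ln 2 * 2 powr (- real_of_int j * \<xi>)) = \<bar>real_of_int j\<bar> * (ln 2 * 2 powr (- real_of_int j * \<xi>))"
      by (simp add: abs_mult)
    also have "\<dots> \<le> \<bar>real_of_int j\<bar> * (1 * (2 powr (- real_of_int j * a) + 2 powr (- real_of_int j * b)))"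
      using ln_le_minus_one[of 2] by (intro mult_left_mono mult_mono dyadic_powr_le_endpoints[OF \<xi>]) auto
    finally show "norm (- real_of_int j * ln 2 * 2 powr (- real_of_int j * \<xi>))
      \<le> \<bar>real_of_int j\<bar> * (2 powr (- real_of_int j * a) + 2 powr (- real_of_int j * b))" by simp
  qed (use assms in auto)
  then show ?thesis by (simp add: mult.commute)
qed

section \<open>The modulus of continuity of the field\<close>

theorem mainTheorem3:
  fixes \<alpha> M a b :: real and \<psi> :: "real \<Rightarrow> real" and eps :: "int \<Rightarrow> int \<Rightarrow> real"
  assumes "1 < \<alpha>" and "\<alpha> < 2"
    and "smooth_cs_wavelet \<psi>"
    and "in_Omega0 \<alpha> eps" and "in_Omega1 \<alpha> eps"
    and "M > 0" and "1/\<alpha> < a" and "a < b" and "b < 1"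
  shows "bdd_above ((\<lambda>(u1, u2, v1, v2).
            \<bar>Xser \<alpha> \<psi> eps u1 v1 - Xser \<alpha> \<psi> eps u2 v2\<bar> /
            (\<bar>u1 - u2\<bar> powr (max v1 v2 - 1/\<alpha>) + \<bar>v1 - v2\<bar>))
          ` ({-M..M} \<times> {-M..M} \<times> {a..b} \<times> {a..b}))"
proof -
  \<comment> \<open>With this choice \<open>q - (1/\<alpha> + \<delta>) = 2 - b - 2 * \<delta> = 1 +
    \<delta>\<close>, and \<open>b + \<delta> < 1\<close> also holds.\<close>
  define \<delta> where "\<delta> = (1 - b) / 3"
  define q where "q = 2 - (b - 1/\<alpha>) - \<delta>"
  have inv: "1/\<alpha> > 0" using assms(1) by simp
  have "b > 0" using assms(7,8) inv by linarith
  moreover have "3 * \<delta> = 1 - b" by (simp add: \<delta>_def)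
  ultimately have \<delta>: "\<delta> > 0" "\<delta> < 1" "b + \<delta> < 1" using assms(9) by linarith+
  have q: "q - (1/\<alpha> + \<delta>) > 1" using assms(9) by (simp add: q_def \<delta>_def field_simps)
  have \<alpha>: "\<alpha> > 0" using assms(1) by simp
  have M: "M > 0" by fact
  have b1: "b - 1/\<alpha> \<le> 1" using assms(9) inv by linarith
  obtain A where A: "A > 0"
    and Psi: "\<And>v. v \<in> {a..b} \<Longrightarrow> decay_lip q A (\<lambda>x. Psi \<alpha> \<psi> x v)"
    and Psi_diff: "\<And>v v'. v \<in> {a..b} \<Longrightarrow> v' \<in> {a..b} \<Longrightarrow>
       decay_lip q (A * \<bar>v - v'\<bar>) (\<lambda>x. Psi \<alpha> \<psi> x v - Psi \<alpha> \<psi> x v')"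
    by (rule Psi_decay_lip[OF assms(3,7) b1 \<delta>(1,2), folded q_def]) (rule that; blast)
  define \<beta> where "\<beta> j = (if j \<ge> 0 then 2 powr (real_of_int j / \<alpha>) else 2 powr (- \<delta> * real_of_int j))" for j :: int
  obtain C where C: "C > 0"
    and coeff: "\<And>j K u. finite K \<Longrightarrow> \<bar>u\<bar> \<le> M \<Longrightarrow>
       (\<Sum>k\<in>K. \<bar>eps j k\<bar> * (1 + \<bar>2 powr (real_of_int j) * u - real_of_int k\<bar>) powr (-q)) \<le> C * \<beta> j"
    by (rule coefficient_sum_bound[OF \<alpha> assms(4,5) M \<delta>(1) q, folded \<beta>_def]) (rule that; blast)
  obtain C1 where C1: "C1 > 0"
    and hol: "\<And>J v h. finite J \<Longrightarrow> v \<in> {a..b} \<Longrightarrow> 0 \<le> h \<Longrightarrow> h \<le> 2 * M \<Longrightarrow>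
       (\<Sum>j\<in>J. 2 powr (- real_of_int j * v) * (\<beta> j * min 1 (2 powr (real_of_int j) * h))) \<le> C1 * h powr (v - 1/\<alpha>)"
    by (rule frequency_sum_holder[OF assms(7) \<alpha> \<delta>(3,1) M, folded \<beta>_def]) (rule that; blast)
  obtain C2 where C2: "C2 > 0"
    and bnd: "\<And>J h. finite J \<Longrightarrow> 0 \<le> h \<Longrightarrow> h \<le> 2 * M \<Longrightarrow>
       (\<Sum>j\<in>J. (1 + \<bar>real_of_int j\<bar>) * (2 powr (- real_of_int j * a) + 2 powr (- real_of_int j * b)) *
          (\<beta> j * min 1 (2 powr (real_of_int j) * h))) \<le> C2"
    by (rule frequency_sum_bounded[OF assms(7) less_imp_le[OF assms(8)] \<delta>(3) M, folded \<beta>_def]) (rule that; blast)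
  have incr: "(\<Sum>k\<in>K. \<bar>eps j k * (P (2 powr (real_of_int j) * u - real_of_int k) - P (2 powr (real_of_int j) * u' - real_of_int k))\<bar>)
      \<le> 2 * A' * (C * \<beta> j * min 1 (2 powr (real_of_int j) * \<bar>u - u'\<bar>))"
    if "decay_lip q A' P" "A' \<ge> 0" "finite K" "\<bar>u\<bar> \<le> M" "\<bar>u'\<bar> \<le> M" for P A' K j u u'
    by (rule decay_lip_increment_sum[OF that(1,2) coeff[OF that(3)] that(4,5)]) simp_all
  \<comment> \<open>Allowing a general base point \<open>u'\<close> covers both the field itself
    (\<open>u' = 0\<close>) and its increments in \<open>u\<close>, where the terms at 0
    cancel.\<close>
  define g where "g v u u' j k = 2 powr (- real_of_int j * v) * (eps j k *
     (Psi \<alpha> \<psi> (2 powr (real_of_int j) * u - real_of_int k) v - Psi \<alpha> \<psi> (2 powr (real_of_int j) * u' - real_of_int k) v))"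
    for v u u' j k
  have X: "Xser \<alpha> \<psi> eps u v = (\<Sum>\<^sub>\<infinity>(j, k)\<in>UNIV. g v u 0 j k)" for u v
    by (simp add: Xser_def g_def mult.assoc)
  have g: "(\<lambda>(j, k). g v u u' j k) summable_on UNIV"
    "\<bar>\<Sum>\<^sub>\<infinity>(j, k)\<in>UNIV. g v u u' j k\<bar> \<le> 2 * A * C * C1 * \<bar>u - u'\<bar> powr (v - 1/\<alpha>)"
    if v: "v \<in> {a..b}" and u: "\<bar>u\<bar> \<le> M" "\<bar>u'\<bar> \<le> M" for u u' v
  proof -
    define H where "H j = 2 powr (- real_of_int j * v) * (2 * A * (C * \<beta> j * min 1 (2 powr (real_of_int j) * \<bar>u - u'\<bar>)))" for j
    have 1: "(\<Sum>k\<in>K. \<bar>g v u u' j k\<bar>) \<le> H j" if "finite K" for j K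
    proof -
      have "(\<Sum>k\<in>K. \<bar>g v u u' j k\<bar>) = 2 powr (- real_of_int j * v) * (\<Sum>k\<in>K. \<bar>eps j k *
         (Psi \<alpha> \<psi> (2 powr (real_of_int j) * u - real_of_int k) v - Psi \<alpha> \<psi> (2 powr (real_of_int j) * u' - real_of_int k) v)\<bar>)"
        unfolding sum_distrib_left g_def by (simp add: abs_mult)
      also have "\<dots> \<le> H j"
        unfolding H_def using incr[OF Psi[OF v] _ that u] A by (intro mult_left_mono) auto
      finally show ?thesis .
    qed
    have 2: "(\<Sum>j\<in>J. H j) \<le> 2 * A * C * C1 * \<bar>u - u'\<bar> powr (v - 1/\<alpha>)" if "finite J" for J
    proof -
      have "(\<Sum>j\<in>J. H j) = 2 * A * C * (\<Sum>j\<in>J. 2 powr (- real_of_int j * v) * (\<beta> j * min 1 (2 powr (real_of_int j) * \<bar>u - u'\<bar>)))"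
        unfolding sum_distrib_left H_def by (simp add: mult_ac)
      also have "\<dots> \<le> 2 * A * C * (C1 * \<bar>u - u'\<bar> powr (v - 1/\<alpha>))"
        using A C u by (intro mult_left_mono hol[OF that v]) auto
      finally show ?thesis by simp
    qed
    show "(\<lambda>(j, k). g v u u' j k) summable_on UNIV"
      by (rule double_series_bound(1)[OF 1 2])
    show "\<bar>\<Sum>\<^sub>\<infinity>(j, k)\<in>UNIV. g v u u' j k\<bar> \<le> 2 * A * C * C1 * \<bar>u - u'\<bar> powr (v - 1/\<alpha>)"
      by (rule double_series_bound(2)[OF 1 2])
  qed
  have X_u: "\<bar>Xser \<alpha> \<psi> eps u v - Xser \<alpha> \<psi> eps u' v\<bar> \<le> 2 * A * C * C1 * \<bar>u - u'\<bar> powr (v - 1/\<alpha>)"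
    if v: "v \<in> {a..b}" and u: "\<bar>u\<bar> \<le> M" "\<bar>u'\<bar> \<le> M" for u u' v
  proof -
    have "Xser \<alpha> \<psi> eps u v - Xser \<alpha> \<psi> eps u' v =
        (\<Sum>\<^sub>\<infinity>z\<in>UNIV. (case z of (j, k) \<Rightarrow> g v u 0 j k) - (case z of (j, k) \<Rightarrow> g v u' 0 j k))"
      unfolding X by (rule infsum_diff[OF g(1) g(1), symmetric]) (use v u M in auto)
    also have "\<dots> = (\<Sum>\<^sub>\<infinity>(j, k)\<in>UNIV. g v u u' j k)"
      by (intro infsum_cong) (auto simp: g_def algebra_simps)
    finally show ?thesis using g(2)[OF v u] by simp
  qed
  have X_v: "\<bar>Xser \<alpha> \<psi> eps u v - Xser \<alpha> \<psi> eps u v'\<bar> \<le> 2 * A * C * C2 * \<bar>v - v'\<bar>"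
    if v: "v \<in> {a..b}" "v' \<in> {a..b}" and u: "\<bar>u\<bar> \<le> M" for u v v'
  proof -
    define m where "m j = \<beta> j * min 1 (2 powr (real_of_int j) * \<bar>u\<bar>)" for j
    have m: "m j \<ge> 0" for j by (simp add: m_def \<beta>_def)
    define L where "L j = 2 powr (- real_of_int j * a) + 2 powr (- real_of_int j * b)" for j :: int
    define H where "H j = 2 * A * C * \<bar>v - v'\<bar> * ((1 + \<bar>real_of_int j\<bar>) * L j * m j)" for j
    have le: "2 powr (- real_of_int j * v) \<le> L j" for j
      unfolding L_def by (rule dyadic_powr_le_endpoints[OF v(1)])
    define d where "d j k = g v u 0 j k - g v' u 0 j k" for j k
    have 1: "(\<Sum>k\<in>K. \<bar>d j k\<bar>) \<le> H j" if K: "finite K" for j K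
    proof -
      define x where "x k = 2 powr (real_of_int j) * u - real_of_int k" for k
      \<comment> \<open>The product with 0 is kept so that \<open>incr\<close> applies with second
        point 0; the increment is then \<open>|u|\<close>.\<close>
      define y where "y k = 2 powr (real_of_int j) * 0 - real_of_int k" for k
      define s where "s = (2::real) powr (- real_of_int j * v)"
      define s' where "s' = (2::real) powr (- real_of_int j * v')"
      define D where "D z = Psi \<alpha> \<psi> z v - Psi \<alpha> \<psi> z v'" for z
      have "\<bar>d j k\<bar> \<le> s * \<bar>eps j k * (D (x k) - D (y k))\<bar> + \<bar>s - s'\<bar> * \<bar>eps j k * (Psi \<alpha> \<psi> (x k) v' - Psi \<alpha> \<psi> (y k) v')\<bar>" for k
      proof -
        \<comment> \<open>Discrete product rule in \<open>v\<close>: the first part varies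
          \<open>Psi\<close>, the second varies the dyadic factor.\<close>
        have "d j k = s * (eps j k * (D (x k) - D (y k))) + (s - s') * (eps j k * (Psi \<alpha> \<psi> (x k) v' - Psi \<alpha> \<psi> (y k) v'))"
          by (simp add: d_def g_def D_def x_def y_def s_def s'_def algebra_simps)
        moreover have "s \<ge> 0" by (simp add: s_def)
        ultimately show ?thesis
          by (metis abs_mult abs_of_nonneg abs_triangle_ineq)
      qed
      then have "(\<Sum>k\<in>K. \<bar>d j k\<bar>) \<le> s * (\<Sum>k\<in>K. \<bar>eps j k * (D (x k) - D (y k))\<bar>) +
          \<bar>s - s'\<bar> * (\<Sum>k\<in>K. \<bar>eps j k * (Psi \<alpha> \<psi> (x k) v' - Psi \<alpha> \<psi> (y k) v')\<bar>)"
        unfolding sum_distrib_left sum.distrib[symmetric] by (intro sum_mono)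
      also have "\<dots> \<le> s * (2 * (A * \<bar>v - v'\<bar>) * (C * m j)) + \<bar>s - s'\<bar> * (2 * A * (C * m j))"
      proof (intro add_mono mult_left_mono)
        show "(\<Sum>k\<in>K. \<bar>eps j k * (D (x k) - D (y k))\<bar>) \<le> 2 * (A * \<bar>v - v'\<bar>) * (C * m j)"
          using incr[OF Psi_diff[OF v] _ K u, of 0 j] A M by (simp add: D_def x_def y_def m_def mult.assoc)
        show "(\<Sum>k\<in>K. \<bar>eps j k * (Psi \<alpha> \<psi> (x k) v' - Psi \<alpha> \<psi> (y k) v')\<bar>) \<le> 2 * A * (C * m j)"
          using incr[OF Psi[OF v(2)] _ K u, of 0 j] A M by (simp add: x_def y_def m_def mult.assoc)
      qed (auto simp: s_def)
      also have "\<dots> = 2 * A * C * m j * (s * \<bar>v - v'\<bar> + \<bar>s - s'\<bar>)"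
        by (simp add: algebra_simps)
      also have "\<dots> \<le> 2 * A * C * m j * (L j * \<bar>v - v'\<bar> + \<bar>v - v'\<bar> * (\<bar>real_of_int j\<bar> * L j))"
        using A C m[of j] le[of j] dyadic_powr_lipschitz[OF v, of j]
        by (intro mult_left_mono add_mono mult_right_mono) (auto simp: s_def s'_def L_def)
      also have "\<dots> = H j" by (simp add: H_def algebra_simps)
      finally show ?thesis .
    qed
    have 2: "(\<Sum>j\<in>J. H j) \<le> 2 * A * C * C2 * \<bar>v - v'\<bar>" if "finite J" for J
    proof -
      have "(\<Sum>j\<in>J. H j) = 2 * A * C * \<bar>v - v'\<bar> * (\<Sum>j\<in>J. (1 + \<bar>real_of_int j\<bar>) * L j * m j)"
        unfolding sum_distrib_left H_def ..
      also have "\<dots> \<le> 2 * A * C * \<bar>v - v'\<bar> * C2"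
        unfolding L_def m_def using A C u M by (intro mult_left_mono bnd[OF that]) auto
      finally show ?thesis by (simp add: mult_ac)
    qed
    have "Xser \<alpha> \<psi> eps u v - Xser \<alpha> \<psi> eps u v' =
        (\<Sum>\<^sub>\<infinity>z\<in>UNIV. (case z of (j, k) \<Rightarrow> g v u 0 j k) - (case z of (j, k) \<Rightarrow> g v' u 0 j k))"
      unfolding X by (rule infsum_diff[OF g(1) g(1), symmetric]) (use v u M in auto)
    also have "\<dots> = (\<Sum>\<^sub>\<infinity>(j, k)\<in>UNIV. d j k)"
      by (intro infsum_cong) (auto simp: d_def)
    also have "\<bar>\<dots>\<bar> \<le> 2 * A * C * C2 * \<bar>v - v'\<bar>"
      by (rule double_series_bound(2)[OF 1 2])
    finally show ?thesis .
  qed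
  define Q where "Q = 2 * A * C * C1 + 2 * A * C * C2"
  have Q: "Q \<ge> 0" "2 * A * C * C1 \<le> Q" "2 * A * C * C2 \<le> Q" using A C C1 C2 by (auto simp: Q_def)
  have main: "\<bar>Xser \<alpha> \<psi> eps u1 v1 - Xser \<alpha> \<psi> eps u2 v2\<bar> \<le> Q * (\<bar>u1 - u2\<bar> powr (max v1 v2 - 1/\<alpha>) + \<bar>v1 - v2\<bar>)"
    if u: "\<bar>u1\<bar> \<le> M" "\<bar>u2\<bar> \<le> M" and v: "v1 \<in> {a..b}" "v2 \<in> {a..b}" for u1 u2 v1 v2
  proof -
    \<comment> \<open>With the larger value as intermediate level, one of the two moves in
      \<open>v\<close> is trivial and the other has length \<open>|v1 - v2|\<close>, while the move
      in \<open>u\<close> gets the required exponent.\<close>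
    define v where "v = max v1 v2"
    have v': "v \<in> {a..b}" using v by (auto simp: v_def)
    have "\<bar>Xser \<alpha> \<psi> eps u1 v1 - Xser \<alpha> \<psi> eps u2 v2\<bar> \<le>
       \<bar>Xser \<alpha> \<psi> eps u1 v - Xser \<alpha> \<psi> eps u2 v\<bar> + (\<bar>Xser \<alpha> \<psi> eps u1 v1 - Xser \<alpha> \<psi> eps u1 v\<bar> + \<bar>Xser \<alpha> \<psi> eps u2 v - Xser \<alpha> \<psi> eps u2 v2\<bar>)"
      by linarith
    also have "\<dots> \<le> 2 * A * C * C1 * \<bar>u1 - u2\<bar> powr (v - 1/\<alpha>) + (2 * A * C * C2 * \<bar>v1 - v\<bar> + 2 * A * C * C2 * \<bar>v - v2\<bar>)"
      using u v v' by (intro add_mono X_u X_v)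
    also have "\<dots> = 2 * A * C * C1 * \<bar>u1 - u2\<bar> powr (v - 1/\<alpha>) + 2 * A * C * C2 * \<bar>v1 - v2\<bar>"
      unfolding distrib_left[symmetric] by (auto simp: v_def max_def)
    also have "\<dots> \<le> Q * \<bar>u1 - u2\<bar> powr (v - 1/\<alpha>) + Q * \<bar>v1 - v2\<bar>"
      using Q by (intro add_mono mult_right_mono) auto
    finally show ?thesis by (simp add: v_def distrib_left)
  qed
  show ?thesis
  proof (rule bdd_aboveI2[of _ _ Q], clarify)
    fix u1 u2 v1 v2
    assume *: "u1 \<in> {-M..M}" "u2 \<in> {-M..M}" "v1 \<in> {a..b}" "v2 \<in> {a..b}"
    define d where "d = \<bar>u1 - u2\<bar> powr (max v1 v2 - 1/\<alpha>) + \<bar>v1 - v2\<bar>"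
    have "d \<ge> 0" by (simp add: d_def)
    moreover have "\<bar>Xser \<alpha> \<psi> eps u1 v1 - Xser \<alpha> \<psi> eps u2 v2\<bar> \<le> Q * d"
      unfolding d_def using * by (intro main) auto
    \<comment> \<open>For \<open>d = 0\<close> the bound \<open>Q * d\<close> forces a zero
      numerator, and division by zero yields 0, in agreement with the convention 0/0 = 0.\<close>
    ultimately show "\<bar>Xser \<alpha> \<psi> eps u1 v1 - Xser \<alpha> \<psi> eps u2 v2\<bar> / d \<le> Q"
      using Q by (cases "d = 0") (auto simp: field_simps)
  qed
qed

end
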